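(* Let $d,r$ be integers with $1\le d<q$ and $1\le r\le\binom{m+d}{m}$. Then there is an integer $e_0$ such that $A_r(d,m;e)=K_r(d,m)$ for all $e\ge e_0$. Consequently, $e_r(d,m)\le K_r(d,m)$.
   Context: Let $q$ be a prime power, $\mathbb{F}_q$ the finite field with $q$ elements, and $m$ a positive integer. For $j\in\mathbb{Z}$ put $\mathsf{p}_j=q^j+q^{j-1}+\dots+q+1$ if $j\ge 0$ and $\mathsf{p}_j=0$ if $j<0$. For homogeneous $F_1,\dots,F_r\in\mathbb{F}_q[x_0,\dots,x_m]$, $V(F_1,\dots,F_r)(\mathbb{F}_q)$ is the set of $\mathbb{F}_q$-rational points of $\mathbb{P}^m$ at which all $F_i$ vanish. $e_r(d,m)$ is the maximum of $|V(F_1,\dots,F_r)(\mathbb{F}_q)|$ over all families of $r$ linearly independent homogeneous polynomials of degree $d$ in $\mathbb{F}_q[x_0,\dots,x_m]$. A monomial $\mu\neq 1$ in $x_0,\dots,x_m$ can be written $\mu=x_0^{a_0}\cdots x_\ell^{a_\ell}$ with $0\le \ell\le m$ and $a_\ell>0$; it is called projectively reduced if $a_0,\dots,a_{\ell-1}\le q-1$; the monomial $1$ is also projectively reduced. Let $\overline{\mathbb{M}}_e$ be the set of projectively reduced monomials of degree $e$. For a set $\mathcal{S}$ of monomials, $\nabla_e(\mathcal{S})=\{\mu\in\overline{\mathbb{M}}_e:\nu\mid\mu \text{ for some }\nu\in\mathcal{S}\}$ and $\Delta_e(\mathcal{S})=\overline{\mathbb{M}}_e\setminus\nabla_e(\mathcal{S})$.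 For $1\le r\le|\overline{\mathbb{M}}_d|$, $A_r(d,m;e)=\max\{|\Delta_e(\mathcal{S})|:\mathcal{S}\subseteq\overline{\mathbb{M}}_d,\ |\mathcal{S}|=r\}$. Lexicographic order on monomials: $x_0^{b_0}\cdots x_m^{b_m}\prec x_0^{a_0}\cdots x_m^{a_m}$ iff at the first index $i$ where the exponents differ one has $a_i>b_i$ (so $x_0\succ x_1\succ\dots\succ x_m$). $K_r(d,m)=\sum_{j=0}^{m-1}a_j\mathsf{p}_{m-1-j}$, where $(a_0,\dots,a_m)$ is the $r$-th element, in descending lexicographic order, of the set of $(m+1)$-tuples of nonnegative integers with sum $d$ (equivalently, $x_0^{a_0}\cdots x_m^{a_m}$ is the $r$-th element of the degree-$d$ monomials listed in descending lexicographic order). *)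

theory Defs
  imports Main "HOL-Library.FuncSet"
begin

text \<open>A monomial x_0^a_0 ... x_m^a_m is represented by its exponent function
  a :: nat => nat with a i = 0 for i > m.\<close>

definition monoms :: "nat \<Rightarrow> nat \<Rightarrow> (nat \<Rightarrow> nat) set" where
  "monoms m e = {a. (\<forall>i>m. a i = 0) \<and> (\<Sum>i\<le>m. a i) = e}"

definition proj_reduced :: "nat \<Rightarrow> (nat \<Rightarrow> nat) \<Rightarrow> bool" where
  "proj_reduced q a \<longleftrightarrow>
     (a = (\<lambda>_. 0) \<or> (\<forall>i < Max {l. 0 < a l}. a i \<le> q - 1))"

definition red_monos :: "nat \<Rightarrow> nat \<Rightarrow> nat \<Rightarrow> (nat \<Rightarrow> nat) set" where
  "red_monos q m e = {a \<in> monoms m e. proj_reduced q a}"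

definition mono_dvd :: "(nat \<Rightarrow> nat) \<Rightarrow> (nat \<Rightarrow> nat) \<Rightarrow> bool" where
  "mono_dvd \<nu> \<mu> \<longleftrightarrow> (\<forall>i. \<nu> i \<le> \<mu> i)"

definition nabla :: "nat \<Rightarrow> nat \<Rightarrow> nat \<Rightarrow> (nat \<Rightarrow> nat) set \<Rightarrow> (nat \<Rightarrow> nat) set" where
  "nabla q m e S = {\<mu> \<in> red_monos q m e. \<exists>\<nu>\<in>S. mono_dvd \<nu> \<mu>}"

definition Delta :: "nat \<Rightarrow> nat \<Rightarrow> nat \<Rightarrow> (nat \<Rightarrow> nat) set \<Rightarrow> (nat \<Rightarrow> nat) set" where
  "Delta q m e S = red_monos q m e - nabla q m e S"

definition A_fun :: "nat \<Rightarrow> nat \<Rightarrow> nat \<Rightarrow> nat \<Rightarrow> nat \<Rightarrow> nat" where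
  "A_fun q r d m e =
     Max {card (Delta q m e S) | S. S \<subseteq> red_monos q m d \<and> card S = r}"

definition lex_less :: "(nat \<Rightarrow> nat) \<Rightarrow> (nat \<Rightarrow> nat) \<Rightarrow> bool" where
  "lex_less b a \<longleftrightarrow> (\<exists>i. (\<forall>j<i. a j = b j) \<and> b i < a i)"

text \<open>p_j = q^j + ... + q + 1 for j >= 0 (only nonnegative indices are used).\<close>
definition pp :: "nat \<Rightarrow> nat \<Rightarrow> nat" where
  "pp q j = (\<Sum>i\<le>j. q ^ i)"

text \<open>The r-th element (r >= 1) of monoms m d in descending lexicographic order:
  the unique one having exactly r-1 elements strictly above it.\<close>
definition lex_nth :: "nat \<Rightarrow> nat \<Rightarrow> nat \<Rightarrow> (nat \<Rightarrow> nat)" where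
  "lex_nth r d m = (THE a. a \<in> monoms m d \<and>
      card {b \<in> monoms m d. lex_less a b} = r - 1)"

definition K_fun :: "nat \<Rightarrow> nat \<Rightarrow> nat \<Rightarrow> nat \<Rightarrow> nat" where
  "K_fun q r d m = (\<Sum>j<m. lex_nth r d m j * pp q (m - 1 - j))"

text \<open>A polynomial is given by its coefficient function on monomials;
  homogeneous of degree d in x_0..x_m means its support lies in monoms m d.\<close>
definition homog :: "nat \<Rightarrow> nat \<Rightarrow> ((nat \<Rightarrow> nat) \<Rightarrow> 'a::field) \<Rightarrow> bool" where
  "homog m d c \<longleftrightarrow> (\<forall>\<mu>. c \<mu> \<noteq> 0 \<longrightarrow> \<mu> \<in> monoms m d)"

definition peval :: "nat \<Rightarrow> nat \<Rightarrow> ((nat \<Rightarrow> nat) \<Rightarrow> 'a::field) \<Rightarrow> (nat \<Rightarrow> 'a) \<Rightarrow> 'a" where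
  "peval m d c x = (\<Sum>\<mu>\<in>monoms m d. c \<mu> * (\<Prod>i\<le>m. x i ^ \<mu> i))"

definition lin_indep :: "nat \<Rightarrow> (nat \<Rightarrow> (nat \<Rightarrow> nat) \<Rightarrow> 'a::field) \<Rightarrow> bool" where
  "lin_indep r F \<longleftrightarrow>
     (\<forall>c::nat \<Rightarrow> 'a. (\<forall>\<mu>. (\<Sum>i<r. c i * F i \<mu>) = 0) \<longrightarrow> (\<forall>i<r. c i = 0))"

text \<open>F_q^{m+1} as functions vanishing beyond m; P^m(F_q) as the quotient of the
  nonzero vectors by nonzero scalar multiples.\<close>
definition vecs :: "nat \<Rightarrow> (nat \<Rightarrow> 'a::field) set" where
  "vecs m = {x. \<forall>i>m. x i = 0}"

definition proj_rel :: "nat \<Rightarrow> ((nat \<Rightarrow> 'a::field) \<times> (nat \<Rightarrow> 'a)) set" where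
  "proj_rel m = {(x, y). x \<in> vecs m - {\<lambda>_. 0} \<and> y \<in> vecs m - {\<lambda>_. 0} \<and>
                        (\<exists>c. c \<noteq> 0 \<and> y = (\<lambda>i. c * x i))}"

definition proj_points :: "nat \<Rightarrow> (nat \<Rightarrow> 'a::field) set set" where
  "proj_points m = (vecs m - {\<lambda>_. 0}) // proj_rel m"

definition zero_set :: "nat \<Rightarrow> nat \<Rightarrow> nat \<Rightarrow> (nat \<Rightarrow> (nat \<Rightarrow> nat) \<Rightarrow> 'a::field)
     \<Rightarrow> (nat \<Rightarrow> 'a) set set" where
  "zero_set m d r F = {P \<in> proj_points m. \<forall>x\<in>P. \<forall>i<r. peval m d (F i) x = 0}"

definition e_fun :: "'a::{field,finite} itself \<Rightarrow> nat \<Rightarrow> nat \<Rightarrow> nat \<Rightarrow> nat" where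
  "e_fun _ r d m = Max {card (zero_set m d r (F :: nat \<Rightarrow> (nat \<Rightarrow> nat) \<Rightarrow> 'a)) | F.
       (\<forall>i<r. homog m d (F i)) \<and> lin_indep r F}"

end

theory Submission
  imports Defs
begin

text \<open>For large degree e, a projectively reduced monomial of degree e is determined by its last
  variable x_l and by its exponents, all below q, in the variables before x_l; the exponent of x_l
  behaves as infinity. Hence the number of monomials of degree e avoiding S does not depend on e.

  Compressing S in two adjacent variables does not enlarge the set of multiples of S, so S may be
  taken strongly stable. Every multiple of a strongly stable S has a unique divisor in S made of its
  leading part, and the number of multiples becomes a weighted sum over the sets of those u in S that
  involve only x_0, ..., x_M, a monomial u having weight q^(m-M) - p_(m-M-1) u_M. This weight is
  nonnegative since d < q. Bigatti's form of Macaulay's theorem says that a lexicographic segment has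
  the fewest monomials in x_0, ..., x_M among stable sets of the same size, and also the largest total
  degree in x_M; thus lexicographic segments minimise the sum. The multiples avoided by the segment
  of all monomials from a upwards are the points lexicographically below a, counted by K.

  For the bound on rational points, the leading monomials of the span of the F_i contain r distinct
  monomials S. Modulo the F_i and x_i^q x_j - x_i x_j^q every form of degree e is, as a function on
  the common zeros, a combination of the monomials avoiding S, while for large e every function
  on the zeros is given by a form of degree e. Counting functions gives the inequality.\<close>

section \<open>Monomials and lexicographic segments\<close>

text \<open>The cut-off of exponents at q is the obstacle: Macaulay's theorem concerns all
  monomials, and in the truncated order an arbitrary S has no evident comparison with a segment.
  Compression is carried out in the truncated order itself, and d < q is what makes it work: the
  exponents in S stay below the cut-off, so the values lost to it at either end of a range of
  multiples never outnumber those gained by raising the degree. The weights arise as follows. For M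
  < m, the multiples assigned to u with last variable x_M number 1 + (q - u_M) p_(m-1-M), and q
  p_(m-1-M) is the sum of q^(m-j) over M \<le> j < m. Distributing this sum over all j \<ge> M gives
  a summand affine in u_j, because u_j = 0 for j > M. So for each j only two statistics of the
  monomials in x_0, ..., x_j count, their number and their total degree in x_j, and a segment is
  extremal for both.\<close>

definition lexseg :: "nat \<Rightarrow> nat \<Rightarrow> (nat \<Rightarrow> nat) set \<Rightarrow> bool" where
  "lexseg n d L \<longleftrightarrow> L \<subseteq> monoms n d \<and> (\<forall>u\<in>L. \<forall>v\<in>monoms n d. lex_less u v \<longrightarrow> v \<in> L)"

lemma monoms_above: "u \<in> monoms n d \<Longrightarrow> n < i \<Longrightarrow> u i = 0"
  by (auto simp: monoms_def)

lemma monoms_sum: "u \<in> monoms n d \<Longrightarrow> (\<Sum>i\<le>n. u i) = d"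
  by (auto simp: monoms_def)

lemma monoms_le: "u \<in> monoms n d \<Longrightarrow> u i \<le> d"
proof (cases "i \<le> n")
  case True
  assume "u \<in> monoms n d"
  then show ?thesis
    using member_le_sum[of i "{..n}" u] True by (auto simp: monoms_def)
qed (auto simp: monoms_def)

lemma sum_fun_upd_nat:
  fixes u :: "nat \<Rightarrow> nat"
  assumes "i \<le> n"
  shows "(\<Sum>l\<le>n. (u(i := x)) l) + u i = (\<Sum>l\<le>n. u l) + x"
proof -
  have "(\<Sum>l\<le>n. (u(i := x)) l) = x + (\<Sum>l\<in>{..n} - {i}. u l)"
    using assms by (subst sum.remove[of _ i]) (auto intro!: sum.cong)
  moreover have "(\<Sum>l\<le>n. u l) = u i + (\<Sum>l\<in>{..n} - {i}. u l)"
    using assms by (subst sum.remove[of _ i]) auto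
  ultimately show ?thesis by simp
qed

lemma monoms_inc:
  "u \<in> monoms n d \<Longrightarrow> i \<le> n \<Longrightarrow> u(i := Suc (u i)) \<in> monoms n (Suc d)"
  using sum_fun_upd_nat[of i n u "Suc (u i)"] by (auto simp: monoms_def)

lemma monoms_dec:
  "u \<in> monoms n (Suc d) \<Longrightarrow> 0 < u i \<Longrightarrow> u(i := u i - 1) \<in> monoms n d"
  using sum_fun_upd_nat[of i n u "u i - 1"] not_less by (fastforce simp: monoms_def)

lemma monoms_0: "monoms n 0 = {\<lambda>_. 0}"
proof -
  have "u = (\<lambda>_. 0)" if "u \<in> monoms n 0" for u
    using monoms_le[OF that] by auto
  moreover have "(\<lambda>_. 0) \<in> monoms n 0" by (simp add: monoms_def)
  ultimately show ?thesis by blast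
qed

lemma monoms_Suc_eq:
  "monoms (Suc n) d = (\<Union>k\<le>d. (\<lambda>v. v(Suc n := k)) ` monoms n (d - k))"
proof (intro subset_antisym subsetI)
  fix u assume u: "u \<in> monoms (Suc n) d"
  have "(\<Sum>i\<le>n. (u(Suc n := 0)) i) = (\<Sum>i\<le>n. u i)"
    by (intro sum.cong) auto
  then have "u(Suc n := 0) \<in> monoms n (d - u (Suc n))"
    using u by (auto simp: monoms_def)
  moreover have "u = (u(Suc n := 0))(Suc n := u (Suc n))" by simp
  ultimately show "u \<in> (\<Union>k\<le>d. (\<lambda>v. v(Suc n := k)) ` monoms n (d - k))"
    using monoms_le[OF u, of "Suc n"] by blast
next
  fix u assume "u \<in> (\<Union>k\<le>d. (\<lambda>v. v(Suc n := k)) ` monoms n (d - k))"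
  then obtain k v where kv: "k \<le> d" "v \<in> monoms n (d - k)" "u = v(Suc n := k)" by blast
  have "(\<Sum>i\<le>n. u i) = (\<Sum>i\<le>n. v i)"
    unfolding kv(3) by (intro sum.cong) auto
  then show "u \<in> monoms (Suc n) d"
    using kv by (auto simp: monoms_def)
qed

lemma inj_on_upd_monoms: "inj_on (\<lambda>v. v(Suc n := k)) (monoms n d)"
proof (rule inj_onI)
  fix u v assume uv: "u \<in> monoms n d" "v \<in> monoms n d" "u(Suc n := k) = v(Suc n := k)"
  show "u = v"
  proof
    fix i show "u i = v i"
      using fun_cong[OF uv(3), of i] uv(1,2) by (cases "i = Suc n") (auto simp: monoms_def)
  qed
qed

lemma finite_monoms: "finite (monoms n d)"
proof (induction n arbitrary: d)
  case 0
  have "monoms 0 d = {(\<lambda>_. 0)(0 := d)}"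
    by (auto simp: monoms_def fun_eq_iff)
  then show ?case by simp
qed (simp add: monoms_Suc_eq)

lemma card_monoms: "card (monoms n d) = (n + d) choose n"
proof (induction n arbitrary: d)
  case 0
  have "monoms 0 d = {(\<lambda>_. 0)(0 := d)}"
    by (auto simp: monoms_def fun_eq_iff)
  then show ?case by simp
next
  case (Suc n)
  have "card (monoms (Suc n) d) = (\<Sum>k\<le>d. card ((\<lambda>v. v(Suc n := k)) ` monoms n (d - k)))"
    unfolding monoms_Suc_eq
    by (intro card_UN_disjoint) (auto simp: finite_monoms dest: fun_upd_eqD)
  also have "\<dots> = (\<Sum>k\<le>d. (n + (d - k)) choose n)"
    by (simp add: card_image[OF inj_on_upd_monoms] Suc)
  also have "\<dots> = (\<Sum>k\<le>d. (n + k) choose n)"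
    by (rule sum.reindex_bij_witness[of _ "\<lambda>k. d - k" "\<lambda>k. d - k"]) auto
  also have "\<dots> = (Suc n + d) choose Suc n"
    by (induction d) auto
  finally show ?case .
qed

section \<open>Lexicographic order, segments and ranks\<close>

lemma lex_less_irrefl: "\<not> lex_less u u"
  by (auto simp: lex_less_def)

lemma lex_less_trans:
  assumes "lex_less u v" "lex_less v w"
  shows "lex_less u w"
proof -
  obtain i j where i: "\<forall>l<i. v l = u l" "u i < v i" and j: "\<forall>l<j. w l = v l" "v j < w j"
    using assms by (auto simp: lex_less_def)
  show ?thesis unfolding lex_less_def
    by (rule exI[of _ "min i j"]) (use i j in \<open>cases i j rule: linorder_cases; auto simp: min_def\<close>)
qed

lemma lex_less_total:
  assumes "u \<noteq> v"
  shows "lex_less u v \<or> lex_less v u"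
proof -
  define i where "i = (LEAST i. u i \<noteq> v i)"
  have "\<exists>i. u i \<noteq> v i" using assms by auto
  then have "u i \<noteq> v i" unfolding i_def by (rule LeastI_ex)
  moreover have "\<forall>j<i. u j = v j" unfolding i_def by (auto dest: not_less_Least)
  ultimately consider "(\<forall>j<i. v j = u j) \<and> u i < v i" | "(\<forall>j<i. u j = v j) \<and> v i < u i"
    by (auto simp: nat_neq_iff)
  then show ?thesis unfolding lex_less_def by blast
qed

text \<open>The least index of disagreement is at most \<open>i\<close>, and domination there fixes
  the direction. Nothing is assumed beyond \<open>i\<close>, so a whole tail may be collected into
  one variable before comparing.\<close>

lemma lex_less_of_dominates:
  assumes "\<forall>l\<le>i. u l \<le> v l" "\<exists>l\<le>i. u l \<noteq> v l"
  shows "lex_less u v"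
proof -
  define j where "j = (LEAST j. j \<le> i \<and> u j \<noteq> v j)"
  have j: "j \<le> i \<and> u j \<noteq> v j"
    unfolding j_def by (rule LeastI_ex) (use assms(2) in auto)
  moreover have "\<forall>l<j. v l = u l"
  proof (intro allI impI)
    fix l assume "l < j"
    then have "\<not> (l \<le> i \<and> u l \<noteq> v l)" unfolding j_def by (rule not_less_Least)
    then show "v l = u l" using \<open>l < j\<close> j by auto
  qed
  ultimately show ?thesis
    unfolding lex_less_def using assms(1) by (intro exI[of _ j]) (auto simp: le_neq_implies_less)
qed

lemma lexseg_nested:
  assumes "lexseg n d L" "lexseg n d L'"
  shows "L \<subseteq> L' \<or> L' \<subseteq> L"
proof (rule ccontr)
  assume "\<not> (L \<subseteq> L' \<or> L' \<subseteq> L)"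
  then obtain u v where uv: "u \<in> L" "u \<notin> L'" "v \<in> L'" "v \<notin> L" by blast
  then have "u \<in> monoms n d" "v \<in> monoms n d" "u \<noteq> v" using assms by (auto simp: lexseg_def)
  then show False
    using uv assms lex_less_total[of u v] unfolding lexseg_def by blast
qed

lemma lexseg_finite: "lexseg n d L \<Longrightarrow> finite L"
  unfolding lexseg_def using finite_monoms finite_subset by blast

lemma lexseg_subset:
  assumes "lexseg n d L" "lexseg n d L'" "card L \<le> card L'"
  shows "L \<subseteq> L'"
  using lexseg_nested[OF assms(1,2)] assms lexseg_finite card_seteq by (metis order_refl)

text \<open>The rank strictly drops when passing to a larger monomial, so it is injective; its
  values lie in an initial segment of the same size, hence it is onto. This gives the definite
  description in \<open>lex_nth\<close> its meaning for every admissible \<open>r\<close>.\<close>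

lemma lex_rank_bij:
  "bij_betw (\<lambda>a. card {b \<in> monoms n d. lex_less a b}) (monoms n d) {..<card (monoms n d)}"
proof -
  let ?rk = "\<lambda>a. card {b \<in> monoms n d. lex_less a b}"
  have less: "?rk b < ?rk a" if "b \<in> monoms n d" "lex_less a b" for a b
  proof (rule psubset_card_mono)
    have "{c \<in> monoms n d. lex_less b c} \<subseteq> {c \<in> monoms n d. lex_less a c}"
      using that lex_less_trans by blast
    then show "{c \<in> monoms n d. lex_less b c} \<subset> {c \<in> monoms n d. lex_less a c}"
      using that lex_less_irrefl by blast
  qed (simp add: finite_monoms)
  have inj: "inj_on ?rk (monoms n d)"
  proof (rule inj_onI)
    fix a b assume "a \<in> monoms n d" "b \<in> monoms n d" "?rk a = ?rk b"
    then show "a = b" using less[of a b] less[of b a] lex_less_total[of a b] by auto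
  qed
  have "?rk a < card (monoms n d)" if "a \<in> monoms n d" for a
    by (rule psubset_card_mono) (use that finite_monoms lex_less_irrefl in auto)
  then have "?rk ` monoms n d \<subseteq> {..<card (monoms n d)}" by auto
  moreover have "card (?rk ` monoms n d) = card (monoms n d)"
    by (rule card_image[OF inj])
  ultimately have "?rk ` monoms n d = {..<card (monoms n d)}"
    by (intro card_subset_eq) auto
  then show ?thesis using inj by (simp add: bij_betw_def)
qed

lemma lex_nth_props:
  assumes "1 \<le> r" "r \<le> (n + d) choose n"
  shows "lex_nth r d n \<in> monoms n d"
    and "card {b \<in> monoms n d. lex_less (lex_nth r d n) b} = r - 1"
proof -
  have "r - 1 \<in> {..<card (monoms n d)}" using assms by (simp add: card_monoms)
  then have "\<exists>!a. a \<in> monoms n d \<and> card {b \<in> monoms n d. lex_less a b} = r - 1"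
    using lex_rank_bij[of n d] unfolding bij_betw_def inj_on_def by (smt (verit) image_iff)
  from theI'[OF this] show "lex_nth r d n \<in> monoms n d"
    and "card {b \<in> monoms n d. lex_less (lex_nth r d n) b} = r - 1"
    unfolding lex_nth_def by auto
qed

definition lex_ge :: "nat \<Rightarrow> nat \<Rightarrow> (nat \<Rightarrow> nat) \<Rightarrow> (nat \<Rightarrow> nat) set" where
  "lex_ge n d a = {b \<in> monoms n d. b = a \<or> lex_less a b}"

lemma lexseg_lex_ge: "lexseg n d (lex_ge n d a)"
  unfolding lexseg_def lex_ge_def using lex_less_trans by blast

lemma card_lex_ge_lex_nth:
  assumes "1 \<le> r" "r \<le> (n + d) choose n"
  shows "card (lex_ge n d (lex_nth r d n)) = r"
proof -
  let ?a = "lex_nth r d n"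
  have "lex_ge n d ?a = insert ?a {b \<in> monoms n d. lex_less ?a b}"
    using lex_nth_props(1)[OF assms] by (auto simp: lex_ge_def)
  then show ?thesis
    using lex_nth_props(2)[OF assms] assms finite_monoms lex_less_irrefl by simp
qed

lemma lexseg_exists:
  assumes "r \<le> card (monoms n d)"
  shows "\<exists>L. lexseg n d L \<and> card L = r"
proof (cases "r = 0")
  case True
  then show ?thesis by (intro exI[of _ "{}"]) (simp add: lexseg_def)
next
  case False
  then show ?thesis
    using assms lexseg_lex_ge card_lex_ge_lex_nth[of r n d] by (auto simp: card_monoms)
qed

section \<open>Strongly stable sets and Bigatti's theorem\<close>

definition stable :: "nat \<Rightarrow> (nat \<Rightarrow> nat) set \<Rightarrow> bool" where
  "stable n B \<longleftrightarrow>
     (\<forall>u\<in>B. \<forall>i j. i < j \<and> j \<le> n \<and> 0 < u j \<longrightarrow> u(j := u j - 1, i := Suc (u i)) \<in> B)"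

definition shad :: "nat \<Rightarrow> (nat \<Rightarrow> nat) set \<Rightarrow> (nat \<Rightarrow> nat) set" where
  "shad n B = {u(j := Suc (u j)) | u j. u \<in> B \<and> j \<le> n}"

definition low :: "nat \<Rightarrow> (nat \<Rightarrow> nat) set \<Rightarrow> (nat \<Rightarrow> nat) set" where
  "low j B = {u \<in> B. \<forall>i>j. u i = 0}"

definition slice :: "nat \<Rightarrow> nat \<Rightarrow> nat \<Rightarrow> (nat \<Rightarrow> nat) set \<Rightarrow> (nat \<Rightarrow> nat) set" where
  "slice n d k B = {v \<in> monoms n (d - k). v(Suc n := k) \<in> B}"

lemma stableD:
  "stable n B \<Longrightarrow> u \<in> B \<Longrightarrow> i < j \<Longrightarrow> j \<le> n \<Longrightarrow> 0 < u j \<Longrightarrow> u(j := u j - 1, i := Suc (u i)) \<in> B"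
  unfolding stable_def by blast

lemma monoms_move:
  assumes "u \<in> monoms n d" "i < j" "j \<le> n" "0 < u j"
  shows "u(j := u j - 1, i := Suc (u i)) \<in> monoms n d"
proof -
  have "0 < d" using monoms_le[OF assms(1), of j] assms(4) by simp
  then obtain d' where d: "d = Suc d'" by (cases d) auto
  have "u(j := u j - 1) \<in> monoms n d'" using monoms_dec assms d by blast
  from monoms_inc[OF this, of i] show ?thesis using assms d by simp
qed

lemma lexseg_stable:
  assumes "lexseg n d L"
  shows "stable n L"
  unfolding stable_def
proof (intro ballI allI impI)
  fix u i j assume u: "u \<in> L" and ij: "i < j \<and> j \<le> n \<and> 0 < u j"
  let ?v = "u(j := u j - 1, i := Suc (u i))"
  have "lex_less u ?v"
    unfolding lex_less_def using ij by (intro exI[of _ i]) auto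
  moreover have "?v \<in> monoms n d"
    using monoms_move u ij assms by (auto simp: lexseg_def)
  ultimately show "?v \<in> L" using assms u unfolding lexseg_def by blast
qed

lemma shad_subset: "B \<subseteq> monoms n d \<Longrightarrow> shad n B \<subseteq> monoms n (Suc d)"
  unfolding shad_def using monoms_inc by auto

lemma stable_shad:
  assumes "stable n B"
  shows "stable n (shad n B)"
  unfolding stable_def
proof (intro ballI allI impI)
  fix w i j assume w: "w \<in> shad n B" and ij: "i < j \<and> j \<le> n \<and> 0 < w j"
  obtain u k where u: "u \<in> B" "k \<le> n" "w = u(k := Suc (u k))" using w by (auto simp: shad_def)
  show "w(j := w j - 1, i := Suc (w i)) \<in> shad n B"
  proof (cases "j = k")
    case True
    then have "w(j := w j - 1, i := Suc (w i)) = u(i := Suc (u i))"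
      using u ij by (auto simp: fun_eq_iff)
    then show ?thesis using u ij unfolding shad_def by (auto intro!: exI[of _ u])
  next
    case False
    let ?v = "u(j := u j - 1, i := Suc (u i))"
    have "?v \<in> B" using stableD[OF assms u(1)] ij False u by auto
    moreover have "w(j := w j - 1, i := Suc (w i)) = ?v(k := Suc (?v k))"
      using u ij False by (auto simp: fun_eq_iff)
    ultimately show ?thesis using u(2) unfolding shad_def by blast
  qed
qed

lemma monoms_last:
  assumes "u \<in> monoms n (Suc d)"
  obtains M where "M \<le> n" "0 < u M" "\<forall>i>M. u i = 0"
proof -
  have ne: "\<exists>i\<le>n. 0 < u i"
  proof (rule ccontr)
    assume "\<not> (\<exists>i\<le>n. 0 < u i)"
    then have "(\<Sum>i\<le>n. u i) = 0" by simp
    then show False using monoms_sum[OF assms] by simp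
  qed
  define M where "M = (GREATEST i. i \<le> n \<and> 0 < u i)"
  have M: "M \<le> n \<and> 0 < u M"
    unfolding M_def by (rule GreatestI_ex_nat[of _ n]) (use ne in auto)
  have "i \<le> M" if "0 < u i" for i
    unfolding M_def by (rule Greatest_le_nat[of _ _ n]) (use that monoms_above[OF assms, of i] in \<open>auto simp: not_less[symmetric]\<close>)
  then have "\<forall>i>M. u i = 0" using not_le by blast
  then show ?thesis using M that by blast
qed

text \<open>A monomial above an element of the shadow is divided by its last variable, the division
  that costs least in the lexicographic order; the quotient is then at or above the element of
  \<open>L\<close> that was enlarged.\<close>

lemma lexseg_shad:
  assumes "lexseg n d L"
  shows "lexseg n (Suc d) (shad n L)"
  unfolding lexseg_def
proof (intro conjI ballI impI)
  show "shad n L \<subseteq> monoms n (Suc d)" using assms shad_subset by (simp add: lexseg_def)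
  fix w w' assume w: "w \<in> shad n L" and w': "w' \<in> monoms n (Suc d)" and less: "lex_less w w'"
  obtain u k where u: "u \<in> L" "k \<le> n" "w = u(k := Suc (u k))" using w by (auto simp: shad_def)
  obtain i where i: "\<forall>l<i. w' l = w l" "w i < w' i" using less by (auto simp: lex_less_def)
  obtain M where M: "M \<le> n" "0 < w' M" "\<forall>l>M. w' l = 0" using monoms_last[OF w'] by blast
  have iM: "i \<le> M" using M(3) i(2) by (metis less_zeroE not_le)
  define u' where "u' = w'(M := w' M - 1)"
  have u': "u' \<in> monoms n d" unfolding u'_def using monoms_dec w' M by blast
  have uw: "u l \<le> w l" for l using u(3) by simp
  have dom: "\<forall>l\<le>i. u l \<le> u' l"
  proof (intro allI impI)
    fix l assume "l \<le> i"
    then consider "l < i" | "l = i" by linarith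
    then show "u l \<le> u' l"
      using uw[of l] i iM unfolding u'_def by cases auto
  qed
  have "u' \<in> L"
  proof (cases "\<exists>l\<le>i. u l \<noteq> u' l")
    case True
    then show ?thesis using lex_less_of_dominates[OF dom] assms u(1) u' unfolding lexseg_def by blast
  next
    case False
    \<comment> \<open>If \<open>u'\<close> agrees with \<open>u\<close> up to \<open>i\<close>, the
      strict gain of \<open>w'\<close> at \<open>i\<close> was cancelled by the division, so x_i is
      the last variable of \<open>w'\<close>, and equality of degrees forces
      \<open>u' = u\<close>.\<close>
    have "M = i"
    proof (rule ccontr)
      assume "M \<noteq> i"
      then show False using False uw[of i] i iM by (auto simp: u'_def)
    qed
    then have "u' l \<le> u l" for l
      using False M(3) by (cases "l \<le> i") (auto simp: u'_def)
    moreover have "(\<Sum>l\<le>n. u' l) = (\<Sum>l\<le>n. u l)"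
      using u' u(1) assms monoms_sum unfolding lexseg_def by (metis subsetD)
    ultimately have "u' l = u l" if "l \<le> n" for l
      by (intro sum_mono_inv[of u' "{..n}" u]) (use that in simp_all)
    moreover have "u' l = u l" if "l > n" for l
      using that monoms_above[OF u'] monoms_above[of u n d] u(1) assms by (auto simp: lexseg_def)
    ultimately have "u' l = u l" for l by (cases "l \<le> n") auto
    then have "u' = u" by (rule ext)
    then show ?thesis using u by simp
  qed
  moreover have "w' = u'(M := Suc (u' M))" using M by (simp add: u'_def)
  ultimately show "w' \<in> shad n L" using M(1) unfolding shad_def by blast
qed

section \<open>Sizes of shadows and restriction to the first variables\<close>

lemma finite_sub_monoms: "B \<subseteq> monoms n d \<Longrightarrow> finite B"
  using finite_monoms finite_subset by blast

text \<open>Dividing an element of the shadow by its last variable x_j lands in \<open>B\<close> by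
  stability, hence in \<open>low j B\<close>; conversely j and u can be recovered from u x_j when u
  involves no variable after x_j. So the shadow is a disjoint union indexed by j.\<close>

lemma card_shad:
  assumes "B \<subseteq> monoms n d" "stable n B"
  shows "card (shad n B) = (\<Sum>j\<le>n. card (low j B))"
proof -
  let ?f = "\<lambda>(j, u). u(j := Suc (u j))"
  have fin: "finite (low j B)" for j
    using finite_sub_monoms[OF assms(1)] by (simp add: low_def)
  have inj: "inj_on ?f (Sigma {..n} (\<lambda>j. low j B))"
  proof (rule inj_onI, clarsimp simp: low_def)
    fix j j' :: nat and u u' :: "nat \<Rightarrow> nat"
    assume 1: "\<forall>i>j. u i = 0" "\<forall>i>j'. u' i = 0"
      and eq: "u(j := Suc (u j)) = u'(j' := Suc (u' j'))"
    have e: "(u(j := Suc (u j))) i = (u'(j' := Suc (u' j'))) i" for i using eq by simp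
    have "j = j'"
      using e[of j] e[of j'] 1 by (cases j j' rule: linorder_cases) auto
    moreover have "u i = u' i" for i
      using e[of i] \<open>j = j'\<close> by (cases "i = j") auto
    ultimately show "j = j' \<and> u = u'" by auto
  qed
  have "?f ` Sigma {..n} (\<lambda>j. low j B) = shad n B"
  proof (intro subset_antisym subsetI)
    fix w assume "w \<in> shad n B"
    then obtain u k where u: "u \<in> B" "k \<le> n" "w = u(k := Suc (u k))" by (auto simp: shad_def)
    have w: "w \<in> monoms n (Suc d)" using u assms(1) monoms_inc by blast
    obtain M where M: "M \<le> n" "0 < w M" "\<forall>l>M. w l = 0" using monoms_last[OF w] by blast
    have kM: "k \<le> M" using M(3) u(3) by (metis fun_upd_same not_le nat.distinct(2))
    have "w(M := w M - 1) \<in> B"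
    proof (cases "k = M")
      case True
      then show ?thesis using u by simp
    next
      case False
      then have "u(M := u M - 1, k := Suc (u k)) \<in> B"
        using stableD[OF assms(2) u(1), of k M] kM M u(3) by auto
      moreover have "w(M := w M - 1) = u(M := u M - 1, k := Suc (u k))"
        using False u(3) by (auto simp: fun_eq_iff)
      ultimately show ?thesis by simp
    qed
    then have "w(M := w M - 1) \<in> low M B" using M(3) by (auto simp: low_def)
    moreover have "w = ?f (M, w(M := w M - 1))" using M by simp
    ultimately show "w \<in> ?f ` Sigma {..n} (\<lambda>j. low j B)" using M(1) by blast
  qed (auto simp: shad_def low_def)
  then have "card (shad n B) = card (Sigma {..n} (\<lambda>j. low j B))"
    using card_image[OF inj] by simp
  then show ?thesis using fin by simp
qed

lemma low_low: "i \<le> j \<Longrightarrow> low i (low j B) = low i B"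
  by (auto simp: low_def)

lemma low_monoms: "B \<subseteq> monoms n d \<Longrightarrow> j \<le> n \<Longrightarrow> low j B \<subseteq> monoms j d"
proof
  fix u assume "B \<subseteq> monoms n d" "j \<le> n" "u \<in> low j B"
  then have u: "u \<in> monoms n d" "\<forall>i>j. u i = 0" by (auto simp: low_def)
  have "(\<Sum>i\<le>n. u i) = (\<Sum>i\<le>j. u i)"
    using u(2) \<open>j \<le> n\<close> by (intro sum.mono_neutral_right) auto
  then show "u \<in> monoms j d" using u by (auto simp: monoms_def)
qed

lemma monoms_mono: "j \<le> n \<Longrightarrow> monoms j d \<subseteq> monoms n d"
proof
  fix u assume "j \<le> n" "u \<in> monoms j d"
  moreover have "(\<Sum>i\<le>n. u i) = (\<Sum>i\<le>j. u i)"
    using calculation by (intro sum.mono_neutral_right) (auto simp: monoms_def)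
  ultimately show "u \<in> monoms n d" by (auto simp: monoms_def)
qed

lemma stable_low: "stable n B \<Longrightarrow> j \<le> n \<Longrightarrow> stable j (low j B)"
  unfolding stable_def low_def by auto

lemma lexseg_low:
  assumes "lexseg n d L" "j \<le> n"
  shows "lexseg j d (low j L)"
  unfolding lexseg_def
proof (intro conjI ballI impI)
  show "low j L \<subseteq> monoms j d" using assms low_monoms[of L n d j] by (simp add: lexseg_def)
  fix u v assume "u \<in> low j L" "v \<in> monoms j d" "lex_less u v"
  then show "v \<in> low j L"
    using assms monoms_mono[OF assms(2), of d] monoms_above[of v j d] unfolding lexseg_def low_def by blast
qed

lemma low_self: "B \<subseteq> monoms n d \<Longrightarrow> low n B = B"
  by (auto simp: low_def monoms_def)

section \<open>Slices by the power of the last variable\<close>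

lemma slice_0: "B \<subseteq> monoms (Suc n) d \<Longrightarrow> slice n d 0 B = low n B"
proof -
  assume B: "B \<subseteq> monoms (Suc n) d"
  have "v(Suc n := 0) = v" if "v \<in> monoms n d" for v
    using monoms_above[OF that, of "Suc n"] by (simp add: fun_eq_iff)
  then show ?thesis using low_monoms[OF B, of n] by (auto simp: slice_def low_def monoms_above)
qed

lemma stable_slice:
  assumes "stable (Suc n) B"
  shows "stable n (slice n d k B)"
  unfolding stable_def
proof (intro ballI allI impI)
  fix u i j assume u: "u \<in> slice n d k B" and ij: "i < j \<and> j \<le> n \<and> 0 < u j"
  let ?v = "u(Suc n := k)"
  have "?v(j := ?v j - 1, i := Suc (?v i)) \<in> B"
    using stableD[OF assms, of ?v i j] u ij by (auto simp: slice_def)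
  moreover have "?v(j := ?v j - 1, i := Suc (?v i)) = (u(j := u j - 1, i := Suc (u i)))(Suc n := k)"
    using ij by (auto simp: fun_eq_iff)
  ultimately show "u(j := u j - 1, i := Suc (u i)) \<in> slice n d k B"
    using monoms_move u ij by (auto simp: slice_def)
qed

text \<open>Strong stability exchanges one factor x_(n+1) for any earlier variable, which lowers the
  slice index by one and multiplies the remaining part by that variable.\<close>

lemma shad_slice:
  assumes "stable (Suc n) B" "Suc k \<le> d"
  shows "shad n (slice n d (Suc k) B) \<subseteq> slice n d k B"
proof
  fix w assume "w \<in> shad n (slice n d (Suc k) B)"
  then obtain u j where u: "u \<in> slice n d (Suc k) B" "j \<le> n" "w = u(j := Suc (u j))"
    by (auto simp: shad_def)
  let ?v = "u(Suc n := Suc k)"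
  have "?v(Suc n := ?v (Suc n) - 1, j := Suc (?v j)) \<in> B"
    using stableD[OF assms(1), of ?v j "Suc n"] u by (auto simp: slice_def)
  moreover have "?v(Suc n := ?v (Suc n) - 1, j := Suc (?v j)) = w(Suc n := k)"
    using u by (auto simp: fun_eq_iff)
  moreover have "w \<in> monoms n (Suc (d - Suc k))"
    using u monoms_inc by (auto simp: slice_def)
  ultimately show "w \<in> slice n d k B"
    using assms(2) by (simp add: slice_def Suc_diff_Suc)
qed

lemma shad_mono: "A \<subseteq> B \<Longrightarrow> shad n A \<subseteq> shad n B"
  by (auto simp: shad_def)

lemma shad_pow_slice:
  assumes "stable (Suc n) B" "k \<le> d"
  shows "(shad n ^^ k) (slice n d k B) \<subseteq> slice n d 0 B"
proof -
  have "i \<le> k \<Longrightarrow> (shad n ^^ i) (slice n d k B) \<subseteq> slice n d (k - i) B" for i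
  proof (induction i)
    case (Suc i)
    then have "(shad n ^^ Suc i) (slice n d k B) \<subseteq> shad n (slice n d (k - i) B)"
      using shad_mono by simp
    also have "\<dots> \<subseteq> slice n d (k - Suc i) B"
      using shad_slice[OF assms(1), of "k - Suc i" d] Suc.prems assms(2) by (simp add: Suc_diff_Suc)
    finally show ?case .
  qed simp
  then show ?thesis by fastforce
qed

lemma shad_pow_last: "u \<in> C \<Longrightarrow> u(n := u n + k) \<in> (shad n ^^ k) C"
proof (induction k)
  case (Suc k)
  have "u(n := u n + Suc k) = (u(n := u n + k))(n := Suc ((u(n := u n + k)) n))" by simp
  then show ?case using Suc unfolding funpow.simps o_def shad_def by blast
qed simp

lemma card_slices:
  assumes "B \<subseteq> monoms (Suc n) d"
  shows "card B = (\<Sum>k\<le>d. card (slice n d k B))"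
proof -
  have B: "B = (\<Union>k\<le>d. (\<lambda>v. v(Suc n := k)) ` slice n d k B)"
    using assms unfolding monoms_Suc_eq slice_def by blast
  have inj: "inj_on (\<lambda>v. v(Suc n := k)) (slice n d k B)" for k
    by (rule inj_on_subset[OF inj_on_upd_monoms[of n k "d - k"]]) (auto simp: slice_def)
  have "card B = (\<Sum>k\<le>d. card ((\<lambda>v. v(Suc n := k)) ` slice n d k B))"
    by (subst B, rule card_UN_disjoint)
      (auto simp: slice_def finite_monoms dest: fun_upd_eqD)
  then show ?thesis by (simp add: card_image[OF inj])
qed

text \<open>By card_shad, the property for n bounds the iterated shadows of the slices of a stable set
  in one more variable; all of these shadows lie in the slice free of the last variable.\<close>

definition lexseg_low_minimal :: "nat \<Rightarrow> bool" where
  "lexseg_low_minimal n \<longleftrightarrow> (\<forall>d B L j. B \<subseteq> monoms n d \<longrightarrow> stable n B \<longrightarrow> lexseg n d L \<longrightarrow> card L \<le> card B \<longrightarrow> j \<le> n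
     \<longrightarrow> card (low j L) \<le> card (low j B))"

text \<open>\<open>card_shad\<close> expresses each shadow through the sizes of \<open>low\<close>,
  which is exactly what \<open>lexseg_low_minimal\<close> compares, so the inequality propagates to
  all iterated shadows.\<close>

lemma shad_pow_growth:
  assumes "lexseg_low_minimal n" "B \<subseteq> monoms n d" "stable n B" "lexseg n d C" "card C \<le> card B"
  shows "lexseg n (d + k) ((shad n ^^ k) C) \<and> card ((shad n ^^ k) C) \<le> card ((shad n ^^ k) B)
    \<and> stable n ((shad n ^^ k) B) \<and> (shad n ^^ k) B \<subseteq> monoms n (d + k)"
proof (induction k)
  case (Suc k)
  let ?B = "(shad n ^^ k) B" and ?C = "(shad n ^^ k) C"
  have "card (shad n ?C) = (\<Sum>j\<le>n. card (low j ?C))"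
    using Suc lexseg_stable by (intro card_shad[of _ _ "d + k"]) (auto simp: lexseg_def)
  also have "\<dots> \<le> (\<Sum>j\<le>n. card (low j ?B))"
    using Suc assms(1) unfolding lexseg_low_minimal_def by (intro sum_mono) auto
  also have "\<dots> = card (shad n ?B)"
    using Suc by (intro card_shad[of _ _ "d + k", symmetric]) auto
  finally show ?case
    using Suc lexseg_shad stable_shad shad_subset by simp
qed (use assms in auto)

text \<open>Both \<open>v\<close> and \<open>c(n := c n + k)\<close> have degree \<open>d\<close> in
  x_0, ..., x_n, so they cannot differ for the first time at x_n. The comparison is decided earlier
  and is not affected when k factors x_n become factors x_(n+1).\<close>

lemma lex_less_move_last:
  assumes "v \<in> monoms n d" "c \<in> monoms n (d - k)" "k \<le> d" "lex_less v (c(n := c n + k))"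
  shows "lex_less v (c(Suc n := k))"
proof -
  obtain i where i: "\<forall>l<i. (c(n := c n + k)) l = v l" "v i < (c(n := c n + k)) i"
    using assms(4) by (auto simp: lex_less_def)
  have "i \<le> n"
    using i(2) monoms_above[OF assms(2), of i] by (cases "i = n") (auto simp: not_le[symmetric])
  moreover have "i \<noteq> n"
  proof
    assume [simp]: "i = n"
    have "(\<Sum>l\<le>n. v l) = v n + (\<Sum>l<n. v l)" "(\<Sum>l\<le>n. c l) = c n + (\<Sum>l<n. c l)"
      by (simp_all add: lessThan_Suc_atMost[symmetric])
    moreover have "(\<Sum>l<n. v l) = (\<Sum>l<n. c l)" using i by (intro sum.cong) auto
    ultimately show False
      using i(2) monoms_sum[OF assms(1)] monoms_sum[OF assms(2)] assms(3)
      unfolding \<open>i = n\<close> fun_upd_same by linarith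
  qed
  ultimately show ?thesis
    unfolding lex_less_def using i by (intro exI[of _ i]) auto
qed

text \<open>Induction on the number of variables. If \<open>L\<close> had too many monomials free of
  x_(n+1), rearranging every slice of \<open>B\<close> into a lexicographic segment would place a
  set of the size of \<open>B\<close> inside \<open>L\<close> with one element removed, against the
  assumption on sizes.\<close>

lemma lexseg_low_minimal_all: "lexseg_low_minimal n"
proof (induction n)
  case 0
  show ?case unfolding lexseg_low_minimal_def
    by (auto simp: low_self lexseg_def)
next
  case (Suc n)
  have key: "card (low n L) \<le> card (low n B)"
    if B: "B \<subseteq> monoms (Suc n) d" "stable (Suc n) B" and L: "lexseg (Suc n) d L" and le: "card L \<le> card B"
    for d B L
  proof (rule ccontr)
    assume "\<not> card (low n L) \<le> card (low n B)"
    then have less: "card (low n B) < card (low n L)" by simp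
    have lexL: "lexseg n d (low n L)" using lexseg_low L by simp
    have "card (low n L) \<le> card (monoms n d)"
      using lexL by (intro card_mono) (auto simp: lexseg_def finite_monoms)
    \<comment> \<open>\<open>M\<close> is the segment as large as \<open>low n B\<close>; a monomial
      \<open>v\<close> of \<open>low n L\<close> outside \<open>M\<close> lies below all of
      \<open>M\<close> and serves as the threshold.\<close>
    then obtain M where M: "lexseg n d M" "card M = card (low n B)"
      using less lexseg_exists[of "card (low n B)" n d] by auto
    have "low n L - M \<noteq> {}"
      using less M lexseg_finite[OF M(1)] card_mono[of M "low n L"] by fastforce
    then obtain v where v: "v \<in> low n L" "v \<notin> M" by blast
    then have vm: "v \<in> monoms n d" using lexL by (auto simp: lexseg_def)
    have vM: "lex_less v w" if "w \<in> M" for w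
      using M(1) v vm that lex_less_total[of v w] unfolding lexseg_def by blast
    have "\<exists>C. lexseg n (d - k) C \<and> card C = card (slice n d k B)" for k
      by (rule lexseg_exists, rule card_mono) (auto simp: finite_monoms slice_def)
    then obtain C where C: "\<And>k. lexseg n (d - k) (C k)" "\<And>k. card (C k) = card (slice n d k B)"
      by metis
    \<comment> \<open>The k-fold shadow of \<open>C k\<close> is no larger than that of the slice,
      which lies in \<open>low n B\<close>; so it is contained in \<open>M\<close>, and everything
      in it exceeds \<open>v\<close>. Multiplying by x_n^k and then trading x_n^k for x_(n+1)^k
      gives an element of \<open>L\<close> other than \<open>v\<close>.\<close>
    have sub: "(\<lambda>c. c(Suc n := k)) ` C k \<subseteq> L - {v}" if k: "k \<le> d" for k
    proof
      fix w assume "w \<in> (\<lambda>c. c(Suc n := k)) ` C k"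
      then obtain c where c: "c \<in> C k" "w = c(Suc n := k)" by blast
      have cm: "c \<in> monoms n (d - k)" using C(1)[of k] c by (auto simp: lexseg_def)
      have g: "lexseg n (d - k + k) ((shad n ^^ k) (C k))"
          "card ((shad n ^^ k) (C k)) \<le> card ((shad n ^^ k) (slice n d k B))"
        using shad_pow_growth[OF Suc.IH, of "slice n d k B" "d - k" "C k" k] stable_slice[OF B(2)] C
        by (auto simp: slice_def)
      have "card ((shad n ^^ k) (slice n d k B)) \<le> card (low n B)"
        using shad_pow_slice[OF B(2) k] slice_0[OF B(1)] finite_sub_monoms[OF B(1)]
        by (intro card_mono) (auto simp: low_def)
      then have "(shad n ^^ k) (C k) \<subseteq> M"
        using g M k by (intro lexseg_subset[of n d]) auto
      then have "lex_less v (c(n := c n + k))" using vM shad_pow_last[OF c(1)] by blast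
      then have vw: "lex_less v w" using lex_less_move_last[OF vm cm k] c(2) by simp
      have "w \<in> monoms (Suc n) d" unfolding monoms_Suc_eq using c cm k by blast
      moreover have "v \<in> L" using v by (simp add: low_def)
      ultimately show "w \<in> L - {v}"
        using vw L lex_less_irrefl unfolding lexseg_def by blast
    qed
    have inj: "inj_on (\<lambda>v. v(Suc n := k)) (C k)" for k
      using inj_on_upd_monoms inj_on_subset C(1)[of k] unfolding lexseg_def by blast
    have "card B = (\<Sum>k\<le>d. card ((\<lambda>c. c(Suc n := k)) ` C k))"
      using card_slices[OF B(1)] by (simp add: card_image[OF inj] C)
    also have "\<dots> = card (\<Union>k\<le>d. (\<lambda>c. c(Suc n := k)) ` C k)"
      using lexseg_finite[OF C(1)]
      by (intro card_UN_disjoint[symmetric]) (auto dest: fun_upd_eqD)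
    also have "\<dots> \<le> card (L - {v})"
      using sub lexseg_finite[OF L] by (intro card_mono) auto
    also have "\<dots> < card L"
      using v lexseg_finite[OF L] by (intro psubset_card_mono) (auto simp: low_def)
    finally show False using le by simp
  qed
  show ?case unfolding lexseg_low_minimal_def
  proof (intro allI impI)
    fix d B L j
    assume B: "B \<subseteq> monoms (Suc n) d" "stable (Suc n) B" and L: "lexseg (Suc n) d L"
      and le: "card L \<le> card B" and j: "j \<le> Suc n"
    show "card (low j L) \<le> card (low j B)"
    proof (cases "j = Suc n")
      case True
      then show ?thesis
        using low_self[OF B(1)] low_self[of L "Suc n" d] L le by (simp add: lexseg_def)
    next
      case False
      then have "card (low j (low n L)) \<le> card (low j (low n B))"
        using Suc.IH key[OF B L le] low_monoms[OF B(1), of n] stable_low[OF B(2), of n] lexseg_low[OF L, of n] j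
        unfolding lexseg_low_minimal_def by auto
      then show ?thesis using False j by (simp add: low_low)
    qed
  qed
qed

lemma card_low_lexseg_le:
  assumes "B \<subseteq> monoms n d" "stable n B" "lexseg n d L" "card L \<le> card B" "j \<le> n"
  shows "card (low j L) \<le> card (low j B)"
  using lexseg_low_minimal_all[of n] assms unfolding lexseg_low_minimal_def by blast

section \<open>Division by the last variable and the total degree in it\<close>

definition quot :: "nat \<Rightarrow> (nat \<Rightarrow> nat) set \<Rightarrow> (nat \<Rightarrow> nat) set" where
  "quot n B = {v. v(n := Suc (v n)) \<in> B}"

lemma quot_image: "quot n B = (\<lambda>u. u(n := u n - 1)) ` {u \<in> B. 0 < u n}"
proof (intro subset_antisym subsetI)
  fix v assume "v \<in> quot n B"
  then have "v(n := Suc (v n)) \<in> {u \<in> B. 0 < u n}" by (simp add: quot_def)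
  moreover have "v = (\<lambda>u. u(n := u n - 1)) (v(n := Suc (v n)))" by simp
  ultimately show "v \<in> (\<lambda>u. u(n := u n - 1)) ` {u \<in> B. 0 < u n}" by blast
qed (auto simp: quot_def)

lemma inj_on_quot: "inj_on (\<lambda>u. u(n := u n - 1)) {u \<in> B. 0 < (u n :: nat)}"
proof (rule inj_onI)
  fix u v :: "'a \<Rightarrow> nat"
  assume "u \<in> {u \<in> B. 0 < u n}" "v \<in> {u \<in> B. 0 < u n}" and e: "u(n := u n - 1) = v(n := v n - 1)"
  then have "0 < u n" "0 < v n" by auto
  show "u = v"
  proof
    fix i show "u i = v i"
      using fun_cong[OF e, of i] fun_cong[OF e, of n] \<open>0 < u n\<close> \<open>0 < v n\<close> by (cases "i = n") auto
  qed
qed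

lemma quot_monoms: "B \<subseteq> monoms n (Suc d) \<Longrightarrow> quot n B \<subseteq> monoms n d"
  unfolding quot_image using monoms_dec by blast

lemma card_quot: "card (quot n B) = card {u \<in> B. 0 < u n}"
  unfolding quot_image by (rule card_image[OF inj_on_quot])

text \<open>Each monomial divisible by x_n contributes one more to the total degree in x_n than its
  quotient does; this recursion reduces the sum to cardinalities.\<close>

lemma sum_quot:
  assumes "finite B"
  shows "(\<Sum>u\<in>B. u n) = card (quot n B) + (\<Sum>v\<in>quot n B. v n)"
proof -
  have "(\<Sum>v\<in>quot n B. v n) = (\<Sum>u | u \<in> B \<and> 0 < u n. u n - 1)"
    unfolding quot_image by (subst sum.reindex[OF inj_on_quot]) simp
  moreover have "(\<Sum>u\<in>B. u n) = (\<Sum>u | u \<in> B \<and> 0 < u n. u n)"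
    using assms by (intro sum.mono_neutral_right) auto
  moreover have "(\<Sum>u | u \<in> B \<and> 0 < u n. u n) = (\<Sum>u | u \<in> B \<and> 0 < u n. (u n - 1) + 1)"
    by (intro sum.cong) auto
  moreover have "\<dots> = (\<Sum>u | u \<in> B \<and> 0 < u n. u n - 1) + card {u \<in> B. 0 < u n}"
    unfolding sum.distrib by simp
  ultimately show ?thesis unfolding card_quot by linarith
qed

lemma stable_quot:
  assumes "stable n B"
  shows "stable n (quot n B)"
  unfolding stable_def
proof (intro ballI allI impI)
  fix v i j assume v: "v \<in> quot n B" and ij: "i < j \<and> j \<le> n \<and> 0 < v j"
  let ?u = "v(n := Suc (v n))"
  have "?u(j := ?u j - 1, i := Suc (?u i)) \<in> B"
    using stableD[OF assms, of ?u i j] v ij by (auto simp: quot_def)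
  moreover have "?u(j := ?u j - 1, i := Suc (?u i))
      = (v(j := v j - 1, i := Suc (v i)))(n := Suc ((v(j := v j - 1, i := Suc (v i))) n))"
    using ij by (auto simp: fun_eq_iff)
  ultimately show "v(j := v j - 1, i := Suc (v i)) \<in> quot n B" by (simp add: quot_def)
qed

lemma lexseg_quot:
  assumes "lexseg n (Suc d) L"
  shows "lexseg n d (quot n L)"
  unfolding lexseg_def
proof (intro conjI ballI impI)
  show "quot n L \<subseteq> monoms n d" using assms quot_monoms by (simp add: lexseg_def)
  fix u v assume u: "u \<in> quot n L" and v: "v \<in> monoms n d" and less: "lex_less u v"
  obtain i where i: "\<forall>l<i. v l = u l" "u i < v i" using less by (auto simp: lex_less_def)
  have "lex_less (u(n := Suc (u n))) (v(n := Suc (v n)))"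
    unfolding lex_less_def using i by (intro exI[of _ i]) auto
  then show "v \<in> quot n L"
    using assms u monoms_inc[OF v, of n] unfolding lexseg_def quot_def by blast
qed

lemma card_pos_last:
  assumes "B \<subseteq> monoms (Suc n) d"
  shows "card {u \<in> B. 0 < u (Suc n)} = card B - card (low n B)"
proof -
  have "{u \<in> B. 0 < u (Suc n)} = B - low n B"
  proof (intro subset_antisym subsetI)
    fix u assume u: "u \<in> B - low n B"
    then obtain i where "i > n" "u i \<noteq> 0" by (auto simp: low_def)
    moreover have "i \<le> Suc n" using u assms monoms_above[of u "Suc n" d i] \<open>u i \<noteq> 0\<close> by (auto simp: not_less[symmetric])
    ultimately have "i = Suc n" by simp
    then show "u \<in> {u \<in> B. 0 < u (Suc n)}" using u \<open>u i \<noteq> 0\<close> by simp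
  qed (auto simp: low_def)
  moreover have "low n B \<subseteq> B" by (auto simp: low_def)
  ultimately show ?thesis
    using finite_sub_monoms[OF assms] by (simp add: card_Diff_subset finite_subset)
qed

text \<open>Monomials involving the last variable form the complement of \<open>low\<close>, so
  fewest without x_n means most with x_n. If x_0 is the only variable, positive degree makes every
  monomial involve it.\<close>

lemma card_pos_last_lexseg:
  assumes "B \<subseteq> monoms n (Suc d)" "stable n B" "lexseg n (Suc d) L" "card B \<le> card L"
  shows "card {u \<in> B. 0 < u n} \<le> card {u \<in> L. 0 < u n}"
proof (cases n)
  case 0
  have "0 < u 0" if "u \<in> monoms 0 (Suc d)" for u using that by (simp add: monoms_def)
  then have "{u \<in> B. 0 < u n} = B" "{u \<in> L. 0 < u n} = L"
    using assms 0 by (auto simp: lexseg_def)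
  then show ?thesis using assms by simp
next
  case (Suc k)
  have "card B \<le> card (monoms n (Suc d))"
    using assms(1) finite_monoms by (rule card_mono[rotated])
  then obtain L' where L': "lexseg n (Suc d) L'" "card L' = card B"
    using lexseg_exists by blast
  have sub: "L' \<subseteq> L" using lexseg_subset[OF L'(1) assms(3)] L' assms(4) by simp
  have "card (low k L') \<le> card (low k B)"
    using card_low_lexseg_le[OF assms(1,2) L'(1), of k] L' Suc by simp
  then have "card {u \<in> B. 0 < u n} \<le> card {u \<in> L'. 0 < u n}"
    using card_pos_last[of B k "Suc d"] card_pos_last[of L' k "Suc d"] assms(1) L' Suc
    by (simp add: lexseg_def)
  also have "\<dots> \<le> card {u \<in> L. 0 < u n}"
    using sub lexseg_finite[OF assms(3)] by (intro card_mono) auto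
  finally show ?thesis .
qed

text \<open>Quotients by x_n inherit stability and the segment property one degree lower, and
  \<open>card_pos_last_lexseg\<close> supplies their size hypothesis; \<open>sum_quot\<close> adds
  the two inequalities up.\<close>

lemma sum_last_lexseg:
  assumes "B \<subseteq> monoms n d" "stable n B" "lexseg n d L" "card B \<le> card L"
  shows "(\<Sum>u\<in>B. u n) \<le> (\<Sum>u\<in>L. u n)"
  using assms
proof (induction d arbitrary: B L)
  case 0
  then have "(\<Sum>u\<in>B. u n) = 0" by (auto simp: monoms_0 intro!: sum.neutral)
  then show ?case by simp
next
  case (Suc d)
  have le: "card (quot n B) \<le> card (quot n L)"
    using card_pos_last_lexseg[OF Suc.prems] by (simp add: card_quot)
  have "(\<Sum>v\<in>quot n B. v n) \<le> (\<Sum>v\<in>quot n L. v n)"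
    by (rule Suc.IH[OF quot_monoms[OF Suc.prems(1)] stable_quot[OF Suc.prems(2)]
        lexseg_quot[OF Suc.prems(3)] le])
  then show ?case
    using le sum_quot[OF finite_sub_monoms[OF Suc.prems(1)], of n] sum_quot[OF lexseg_finite[OF Suc.prems(3)], of n]
    by simp
qed

text \<open>\<open>P * d \<le> A\<close> makes the weights nonnegative, so the segment may first be
  enlarged to the size of \<open>B\<close>; then the constant terms agree and only the total degrees
  in x_n are compared.\<close>

lemma weighted_lexseg_le:
  fixes A P :: int
  assumes B: "B \<subseteq> monoms n d" "stable n B" and L: "lexseg n d L" and le: "card L \<le> card B"
    and P: "0 \<le> P" "P * int d \<le> A"
  shows "(\<Sum>u\<in>L. A - P * int (u n)) \<le> (\<Sum>u\<in>B. A - P * int (u n))"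
proof -
  have "card B \<le> card (monoms n d)" using B(1) finite_monoms by (rule card_mono[rotated])
  then obtain L' where L': "lexseg n d L'" "card L' = card B" using lexseg_exists by blast
  have sub: "L \<subseteq> L'" using lexseg_subset[OF L L'(1)] L' le by simp
  have "P * int (u n) \<le> A" if "u \<in> L'" for u
  proof -
    have "u n \<le> d" using L' that monoms_le by (auto simp: lexseg_def)
    then have "P * int (u n) \<le> P * int d" using P(1) by (intro mult_left_mono) auto
    then show ?thesis using P(2) by simp
  qed
  then have "(\<Sum>u\<in>L. A - P * int (u n)) \<le> (\<Sum>u\<in>L'. A - P * int (u n))"
    using sub lexseg_finite[OF L'(1)] by (intro sum_mono2) auto
  also have "\<dots> = int (card B) * A - P * int (\<Sum>u\<in>L'. u n)"
    by (simp add: sum_subtractf sum_distrib_left L')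
  also have "\<dots> \<le> int (card B) * A - P * int (\<Sum>u\<in>B. u n)"
  proof -
    have "int (\<Sum>u\<in>B. u n) \<le> int (\<Sum>u\<in>L'. u n)"
      using sum_last_lexseg[OF B L'(1)] L' by linarith
    then show ?thesis using P(1) mult_left_mono by fastforce
  qed
  also have "\<dots> = (\<Sum>u\<in>B. A - P * int (u n))"
    by (simp add: sum_subtractf sum_distrib_left)
  finally show ?thesis .
qed

section \<open>Counting multiples of a stable set\<close>

text \<open>The pair (l, b) stands for the reduced monomials of large degree with last variable x_l and
  exponents b before it.\<close>

definition pts :: "nat \<Rightarrow> nat \<Rightarrow> (nat \<times> (nat \<Rightarrow> nat)) set" where
  "pts q m = {(l, b). l \<le> m \<and> (\<forall>i<l. b i < q) \<and> (\<forall>i\<ge>l. b i = 0)}"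

text \<open>There is no condition at index \<open>fst p\<close>, where the exponent of the point
  counts as infinite; later variables do not occur in the point.\<close>

definition pdvd :: "(nat \<Rightarrow> nat) \<Rightarrow> nat \<times> (nat \<Rightarrow> nat) \<Rightarrow> bool" where
  "pdvd u p \<longleftrightarrow> (\<forall>i<fst p. u i \<le> snd p i) \<and> (\<forall>i>fst p. u i = 0)"

definition up :: "nat \<Rightarrow> nat \<Rightarrow> (nat \<Rightarrow> nat) set \<Rightarrow> (nat \<times> (nat \<Rightarrow> nat)) set" where
  "up q m S = {p \<in> pts q m. \<exists>u\<in>S. pdvd u p}"

lemma card_bounded_functions:
  fixes A :: "nat \<Rightarrow> nat set"
  shows "card {b. (\<forall>i<l. b i \<in> A i) \<and> (\<forall>i\<ge>l. b i = 0)} = (\<Prod>i<l. card (A i))"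
proof -
  let ?T = "{b. (\<forall>i<l. b i \<in> A i) \<and> (\<forall>i\<ge>l. b i = 0)}"
  have "bij_betw (\<lambda>b. restrict b {..<l}) ?T (PiE {..<l} A)"
  proof (rule bij_betw_imageI)
    show "inj_on (\<lambda>b. restrict b {..<l}) ?T"
    proof (rule inj_onI, rule ext)
      fix b c i assume bc: "b \<in> ?T" "c \<in> ?T" "restrict b {..<l} = restrict c {..<l}"
      show "b i = c i"
        using fun_cong[OF bc(3), of i] bc(1,2) by (cases "i < l") auto
    qed
    show "(\<lambda>b. restrict b {..<l}) ` ?T = PiE {..<l} A"
    proof (intro subset_antisym subsetI)
      fix f assume f: "f \<in> PiE {..<l} A"
      have "f = restrict (\<lambda>i. if i < l then f i else 0) {..<l}"
      proof
        fix i show "f i = restrict (\<lambda>i. if i < l then f i else 0) {..<l} i"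
          using PiE_arb[OF f, of i] by (cases "i < l") auto
      qed
      moreover have "(\<lambda>i. if i < l then f i else 0) \<in> ?T" using f by (auto dest: PiE_mem)
      ultimately show "f \<in> (\<lambda>b. restrict b {..<l}) ` ?T" by blast
    qed (auto simp: PiE_def)
  qed
  then have "card ?T = card (PiE {..<l} A)" by (simp add: bij_betw_same_card)
  then show ?thesis by (simp add: card_PiE)
qed

lemma finite_bounded_functions:
  fixes l q :: nat
  shows "finite {b. (\<forall>i<l. b i < q) \<and> (\<forall>i\<ge>l. b i = (0::nat))}"
proof -
  have "{b. (\<forall>i<l. b i < q) \<and> (\<forall>i\<ge>l. b i = 0)} \<subseteq> (\<lambda>f i. if i < l then f i else 0) ` (PiE {..<l} (\<lambda>_. {..<q}))"
  proof
    fix b assume "b \<in> {b. (\<forall>i<l. b i < q) \<and> (\<forall>i\<ge>l. b i = 0)}"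
    then show "b \<in> (\<lambda>f i. if i < l then f i else 0) ` (PiE {..<l} (\<lambda>_. {..<q}))"
      by (intro image_eqI[of _ _ "restrict b {..<l}"]) (auto simp: fun_eq_iff not_less)
  qed
  then show ?thesis by (rule finite_subset) (simp add: finite_PiE)
qed

lemma finite_pts: "finite (pts q m)"
proof -
  have "pts q m = Sigma {..m} (\<lambda>l. {b. (\<forall>i<l. b i < q) \<and> (\<forall>i\<ge>l. b i = 0)})"
    by (auto simp: pts_def)
  then show ?thesis by (simp only: finite_SigmaI[OF finite_atMost finite_bounded_functions])
qed

text \<open>For a given last variable x_l the entries strictly between \<open>j\<close> and
  \<open>l\<close> are free, which gives q^(l-1-j); summing over l > j yields p_(m-1-j).
  \<open>X\<close> will be the interval below a_j for the complement of a segment, and the interval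
  from u_M up to q for the pieces of a stable set.\<close>

lemma card_cylinder:
  assumes "j < m" "\<forall>i<j. a i < q" "X \<subseteq> {..<q}"
  shows "card {(l, b) \<in> pts q m. j < l \<and> (\<forall>i<j. b i = a i) \<and> b j \<in> X} = card X * pp q (m - 1 - j)"
proof -
  let ?A = "\<lambda>i. if i < j then {a i} else if i = j then X else {..<q}"
  let ?T = "\<lambda>l. {b. (\<forall>i<l. b i \<in> ?A i) \<and> (\<forall>i\<ge>l. b i = 0)}"
  have eq: "{(l, b) \<in> pts q m. j < l \<and> (\<forall>i<j. b i = a i) \<and> b j \<in> X} = Sigma {j<..m} ?T"
    using assms(2,3) by (auto simp: pts_def split: if_splits)
  have fin: "finite (?T l)" if "j < l" for l
    by (rule finite_subset[OF _ finite_bounded_functions[of l q]])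
      (use assms(2,3) in \<open>auto split: if_splits\<close>)
  have card: "card (?T l) = card X * q ^ (l - 1 - j)" if "j < l" for l
  proof -
    have "{..<l} = {..<j} \<union> {j} \<union> {j<..<l}" using that by auto
    then have "(\<Prod>i<l. card (?A i)) = (\<Prod>i\<in>{..<j} \<union> {j} \<union> {j<..<l}. card (?A i))" by simp
    also have "\<dots> = (\<Prod>i<j. card (?A i)) * card X * (\<Prod>i\<in>{j<..<l}. card (?A i))"
      by (subst prod.union_disjoint; (subst prod.union_disjoint)?) auto
    also have "(\<Prod>i<j. card (?A i)) = 1" by (intro prod.neutral) auto
    also have "(\<Prod>i\<in>{j<..<l}. card (?A i)) = (\<Prod>i\<in>{j<..<l}. q)" by (intro prod.cong) auto
    also have "\<dots> = q ^ (l - 1 - j)" by simp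
    finally show ?thesis by (simp add: card_bounded_functions)
  qed
  have "card (Sigma {j<..m} ?T) = (\<Sum>l\<in>{j<..m}. card X * q ^ (l - 1 - j))"
    using fin card by (subst card_SigmaI) auto
  also have "\<dots> = card X * (\<Sum>l\<in>{j<..m}. q ^ (l - 1 - j))" by (simp add: sum_distrib_left)
  also have "(\<Sum>l\<in>{j<..m}. q ^ (l - 1 - j)) = (\<Sum>i\<le>m - 1 - j. q ^ i)"
    using assms(1) by (intro sum.reindex_bij_witness[of _ "\<lambda>i. i + 1 + j" "\<lambda>l. l - 1 - j"]) auto
  finally show ?thesis unfolding eq pp_def .
qed

lemma sum_split_at:
  fixes f :: "nat \<Rightarrow> nat"
  assumes "k \<le> m"
  shows "(\<Sum>i\<le>m. f i) = (\<Sum>i<k. f i) + f k + (\<Sum>i\<in>{k<..m}. f i)"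
proof -
  have "{..m} = {..<k} \<union> insert k {k<..m}" using assms by auto
  then have "(\<Sum>i\<le>m. f i) = (\<Sum>i<k. f i) + (\<Sum>i\<in>insert k {k<..m}. f i)"
    by (simp only:) (rule sum.union_disjoint, auto)
  then show ?thesis by simp
qed

text \<open>The infinite exponent of x_l absorbs all degree left over, so a point escapes the
  segment only when its entries fall below \<open>a\<close> at some index before \<open>l\<close>;
  agreement with \<open>a\<close> all the way to x_l already makes it a multiple.\<close>

lemma not_up_lex_ge:
  assumes a: "a \<in> monoms m d" and p: "(l, b) \<in> pts q m"
  shows "(l, b) \<notin> up q m (lex_ge m d a) \<longleftrightarrow> (\<exists>j<l. (\<forall>i<j. b i = a i) \<and> b j < a j)"
proof
  assume "\<exists>j<l. (\<forall>i<j. b i = a i) \<and> b j < a j"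
  then obtain j where j: "j < l" "\<forall>i<j. b i = a i" "b j < a j" by blast
  have "\<not> pdvd u (l, b)" if u: "u \<in> lex_ge m d a" for u
  proof
    assume "pdvd u (l, b)"
    then have ub: "u i \<le> b i" if "i < l" for i using that by (simp add: pdvd_def)
    have "u \<noteq> a" using ub[OF j(1)] j(3) by auto
    then have "lex_less a u" using u by (simp add: lex_ge_def)
    then obtain i where i: "\<forall>k<i. u k = a k" "a i < u i" by (auto simp: lex_less_def)
    show False
    proof (cases "i < j")
      case True
      then show ?thesis using ub[of i] i(2) j by simp
    next
      case False
      then have "u j \<ge> a j" using i by (cases "i = j") auto
      then show ?thesis using ub[OF j(1)] j(3) by simp
    qed
  qed
  then show "(l, b) \<notin> up q m (lex_ge m d a)" by (auto simp: up_def)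
next
  assume np: "(l, b) \<notin> up q m (lex_ge m d a)"
  show "\<exists>j<l. (\<forall>i<j. b i = a i) \<and> b j < a j"
  proof (rule ccontr)
    assume no: "\<not> (\<exists>j<l. (\<forall>i<j. b i = a i) \<and> b j < a j)"
    have lm: "l \<le> m" using p by (simp add: pts_def)
    have nd: "\<not> pdvd u (l, b)" if "u \<in> lex_ge m d a" for u
      using np p that by (auto simp: up_def)
    have part: "(\<Sum>i<k. a i) + (\<Sum>i\<in>{k..m}. a i) = d" if "k \<le> Suc m" for k
    proof -
      have "{..m} = {..<k} \<union> {k..m}" using that by auto
      then have "(\<Sum>i\<le>m. a i) = (\<Sum>i<k. a i) + (\<Sum>i\<in>{k..m}. a i)"
        by (simp only:) (rule sum.union_disjoint, auto)
      then show ?thesis using monoms_sum[OF a] by simp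
    qed
    show False
    proof (cases "\<forall>i<l. b i = a i")
      case True
      \<comment> \<open>Keeps \<open>a\<close> before x_l and puts the whole remaining degree on
        x_l: this divides the point and is at or above \<open>a\<close>.\<close>
      define u where "u = (\<lambda>i. if i < l then a i else if i = l then \<Sum>i\<in>{l..m}. a i else 0)"
      have "(\<Sum>i\<le>m. u i) = (\<Sum>i<l. a i) + (\<Sum>i\<in>{l..m}. a i)"
      proof -
        have "(\<Sum>i\<le>m. u i) = (\<Sum>i<l. u i) + u l + (\<Sum>i\<in>{l<..m}. u i)"
          using sum_split_at[OF lm] by simp
        moreover have "(\<Sum>i<l. u i) = (\<Sum>i<l. a i)" by (intro sum.cong) (auto simp: u_def)
        moreover have "(\<Sum>i\<in>{l<..m}. u i) = 0" by (intro sum.neutral) (auto simp: u_def)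
        ultimately show ?thesis by (simp add: u_def)
      qed
      then have um: "u \<in> monoms m d" using part[of l] lm by (auto simp: monoms_def u_def)
      have "a l \<le> (\<Sum>i\<in>{l..m}. a i)" using lm by (intro member_le_sum) auto
      then have dom: "\<forall>i\<le>l. a i \<le> u i" by (auto simp: u_def)
      have "u = a \<or> lex_less a u"
      proof (cases "\<exists>i\<le>l. a i \<noteq> u i")
        case True
        then show ?thesis using lex_less_of_dominates[OF dom] by simp
      next
        case False
        then have ale: "a l = (\<Sum>i\<in>{l..m}. a i)" by (auto simp: u_def)
        have "{l..m} = insert l {l<..m}" using lm by auto
        then have "(\<Sum>i\<in>{l<..m}. a i) = 0" using ale by simp
        then have "a i = 0" if "i > l" for i
          using that monoms_above[OF a, of i] by (cases "i \<le> m") auto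
        then have "u i = a i" for i using False by (cases "i \<le> l") (auto simp: u_def)
        then have "u = a" by (rule ext)
        then show ?thesis ..
      qed
      then have "u \<in> lex_ge m d a" using um by (simp add: lex_ge_def)
      moreover have "pdvd u (l, b)" using True by (auto simp: pdvd_def u_def)
      ultimately show False using nd by blast
    next
      case False
      define j where "j = (LEAST i. i < l \<and> b i \<noteq> a i)"
      have j: "j < l \<and> b j \<noteq> a j" unfolding j_def by (rule LeastI_ex) (use False in auto)
      have bef: "b i = a i" if "i < j" for i
        using not_less_Least[of i "\<lambda>i. i < l \<and> b i \<noteq> a i"] that j unfolding j_def by auto
      have gt: "a j < b j" using no j bef by (metis linorder_neqE_nat)
      \<comment> \<open>The degree of \<open>a\<close> after x_j. If it is 0, \<open>a\<close>
        itself divides the point; otherwise one unit goes to x_j, where \<open>b\<close> has room,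
        and the other R - 1 units go to x_l.\<close>
      define R where "R = (\<Sum>i\<in>{Suc j..m}. a i)"
      have split: "(\<Sum>i<j. a i) + a j + R = d"
        using part[of "Suc j"] j lm by (simp add: R_def)
      show False
      proof (cases "R = 0")
        case True
        then have "a i = 0" if "i > j" for i
          using that monoms_above[OF a, of i] by (cases "i \<le> m") (auto simp: R_def)
        moreover have "a \<in> lex_ge m d a" using a by (simp add: lex_ge_def)
        moreover have "pdvd a (l, b)"
        proof -
          have "a i \<le> b i" if "i < l" for i
            using bef[of i] gt calculation(1)[of i] by (cases i j rule: linorder_cases) auto
          moreover have "a i = 0" if "i > l" for i
            using \<open>\<And>i. j < i \<Longrightarrow> a i = 0\<close>[of i] that j by simp
          ultimately show ?thesis by (simp add: pdvd_def)
        qed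
        ultimately show False using nd by blast
      next
        case False
        define u where "u = (\<lambda>i. if i < j then a i else if i = j then Suc (a j) else if i = l then R - 1 else 0)"
        have "(\<Sum>i\<le>m. u i) = (\<Sum>i<j. a i) + Suc (a j) + (R - 1)"
        proof -
          have "(\<Sum>i\<le>m. u i) = (\<Sum>i<j. u i) + u j + (\<Sum>i\<in>{j<..m}. u i)"
            using sum_split_at[of j m] lm j by simp
          moreover have "(\<Sum>i<j. u i) = (\<Sum>i<j. a i)" by (intro sum.cong) (auto simp: u_def)
          moreover have "(\<Sum>i\<in>{j<..m}. u i) = (\<Sum>i\<in>{j<..m}. if i = l then R - 1 else 0)"
            by (intro sum.cong) (auto simp: u_def)
          ultimately show ?thesis using j lm by (simp add: u_def)
        qed
        then have "u \<in> monoms m d" using split False lm j by (auto simp: monoms_def u_def)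
        moreover have "lex_less a u"
          unfolding lex_less_def by (rule exI[of _ j]) (auto simp: u_def)
        ultimately have "u \<in> lex_ge m d a" by (simp add: lex_ge_def)
        moreover have "pdvd u (l, b)" using bef gt j by (auto simp: pdvd_def u_def)
        ultimately show False using nd by blast
      qed
    qed
  qed
qed

text \<open>Sorting by the first index j where b differs from \<open>a\<close> leaves a_j values for
  b_j. By \<open>d < q\<close> all of these values, and the entries of \<open>a\<close> before j,
  are legitimate exponents of a point.\<close>

lemma card_lex_ge_complement:
  assumes a: "a \<in> monoms m d" and d: "d < q"
  shows "card (pts q m - up q m (lex_ge m d a)) = (\<Sum>j<m. a j * pp q (m - 1 - j))"
proof -
  let ?Z = "\<lambda>j. {(l, b) \<in> pts q m. j < l \<and> (\<forall>i<j. b i = a i) \<and> b j \<in> {..<a j}}"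
  have aq: "a i < q" for i using monoms_le[OF a, of i] d by simp
  have "pts q m - up q m (lex_ge m d a) = (\<Union>j<m. ?Z j)"
  proof (intro subset_antisym subsetI)
    fix p assume "p \<in> pts q m - up q m (lex_ge m d a)"
    then obtain l b where p: "p = (l, b)" "(l, b) \<in> pts q m" "(l, b) \<notin> up q m (lex_ge m d a)"
      by (cases p) auto
    then obtain j where "j < l" "\<forall>i<j. b i = a i" "b j < a j" using not_up_lex_ge[OF a] by blast
    then show "p \<in> (\<Union>j<m. ?Z j)" using p by (auto simp: pts_def intro!: bexI[of _ j])
  next
    fix p assume "p \<in> (\<Union>j<m. ?Z j)"
    then show "p \<in> pts q m - up q m (lex_ge m d a)" using not_up_lex_ge[OF a] by auto
  qed
  then have "card (pts q m - up q m (lex_ge m d a)) = card (\<Union>j<m. ?Z j)" by simp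
  also have "\<dots> = (\<Sum>j<m. card (?Z j))"
  proof (rule card_UN_disjoint)
    show "\<forall>j\<in>{..<m}. finite (?Z j)" by (auto intro: finite_subset[OF _ finite_pts[of q m]])
    show "\<forall>j\<in>{..<m}. \<forall>k\<in>{..<m}. j \<noteq> k \<longrightarrow> ?Z j \<inter> ?Z k = {}"
    proof (intro ballI impI)
      fix j k :: nat assume "j \<noteq> k"
      then show "?Z j \<inter> ?Z k = {}" by (cases j k rule: linorder_cases) auto
    qed
  qed simp
  also have "\<dots> = (\<Sum>j<m. card {..<a j} * pp q (m - 1 - j))"
  proof (intro sum.cong refl card_cylinder)
    fix j show "{..<a j} \<subseteq> {..<q}" using aq[of j] by auto
  qed (use aq in auto)
  finally show ?thesis by simp
qed

section \<open>Partition of the multiples of a stable set\<close>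

definition mx :: "(nat \<Rightarrow> nat) \<Rightarrow> nat" where
  "mx u = Max {i. 0 < u i}"

lemma mx_eqI:
  assumes "0 < u M" "\<forall>i>M. u i = 0"
  shows "mx u = M"
proof -
  have sub: "{i. 0 < u i} \<subseteq> {..M}" using assms(2) by (auto simp: not_less[symmetric])
  show ?thesis unfolding mx_def
    by (rule Max_eqI) (use assms sub finite_subset[OF sub] in auto)
qed

lemma mx_props:
  assumes "u \<in> monoms m d" "0 < d"
  shows "mx u \<le> m" "0 < u (mx u)" "\<And>i. mx u < i \<Longrightarrow> u i = 0"
proof -
  obtain d' where "d = Suc d'" using assms(2) by (cases d) auto
  then obtain M where M: "M \<le> m" "0 < u M" "\<forall>i>M. u i = 0" using monoms_last assms(1) by blast
  then have "mx u = M" by (intro mx_eqI)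
  then show "mx u \<le> m" "0 < u (mx u)" "\<And>i. mx u < i \<Longrightarrow> u i = 0" using M by auto
qed

text \<open>The points whose lexicographically greatest divisor of degree d is u.\<close>

definition cyl :: "nat \<Rightarrow> nat \<Rightarrow> (nat \<Rightarrow> nat) \<Rightarrow> (nat \<times> (nat \<Rightarrow> nat)) set" where
  "cyl q m u = {(l, b) \<in> pts q m. mx u \<le> l \<and> (\<forall>i<mx u. b i = u i) \<and> (mx u < l \<longrightarrow> u (mx u) \<le> b (mx u))}"

text \<open>The summand 1 is the point with the same last variable x_M as \<open>u\<close>; the
  other points have a later last variable, and their entry at M runs from u_M to q - 1.\<close>

lemma card_cyl:
  assumes u: "u \<in> monoms m d" and d: "0 < d" "d < q"
  shows "card (cyl q m u) = 1 + (if mx u < m then (q - u (mx u)) * pp q (m - 1 - mx u) else 0)"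
proof -
  define M where "M = mx u"
  note M = mx_props[OF u d(1), folded M_def]
  have uq: "u i < q" for i using monoms_le[OF u, of i] d by simp
  let ?p = "(M, \<lambda>i. if i < M then u i else 0)"
  let ?Z = "{(l, b) \<in> pts q m. M < l \<and> (\<forall>i<M. b i = u i) \<and> b M \<in> {u M..<q}}"
  have eq: "cyl q m u = insert ?p ?Z"
  proof (intro subset_antisym subsetI)
    fix p assume "p \<in> cyl q m u"
    then obtain l b where p: "p = (l, b)" "(l, b) \<in> pts q m" "M \<le> l" "\<forall>i<M. b i = u i"
        "M < l \<longrightarrow> u M \<le> b M"
      by (cases p) (auto simp: cyl_def M_def)
    show "p \<in> insert ?p ?Z"
    proof (cases "M = l")
      case True
      then have "b = (\<lambda>i. if i < M then u i else 0)" using p by (auto simp: pts_def fun_eq_iff)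
      then show ?thesis using p(1) True by simp
    next
      case False
      then show ?thesis using p by (auto simp: pts_def)
    qed
  next
    fix p assume "p \<in> insert ?p ?Z"
    then show "p \<in> cyl q m u" using M(1) uq by (auto simp: cyl_def M_def pts_def)
  qed
  have fin: "finite ?Z" by (rule finite_subset[OF _ finite_pts[of q m]]) auto
  have "card (cyl q m u) = 1 + card ?Z" unfolding eq using fin by (subst card_insert_disjoint) auto
  also have "card ?Z = (if M < m then (q - u M) * pp q (m - 1 - M) else 0)"
  proof (cases "M < m")
    case True
    have "{u M..<q} \<subseteq> {..<q}" by auto
    then show ?thesis using card_cylinder[OF True, of u q "{u M..<q}"] uq True by simp
  next
    case False
    then have "?Z = {}" by (auto simp: pts_def)
    then show ?thesis using False by (simp only: card.empty if_False)
  qed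
  finally show ?thesis by (simp add: M_def)
qed

text \<open>A common point shows the entries of both monomials before their last variables, so the
  one with the earlier last variable divides the other; equal degree makes them equal.\<close>

lemma cyl_disjoint:
  assumes u: "u \<in> monoms m d" and v: "v \<in> monoms m d" and d: "0 < d" and ne: "u \<noteq> v"
  shows "cyl q m u \<inter> cyl q m v = {}"
proof -
  have wlog: False
    if u: "u \<in> monoms m d" and v: "v \<in> monoms m d" and ne: "u \<noteq> v" and le: "mx u \<le> mx v"
      and p: "(l, b) \<in> cyl q m u" "(l, b) \<in> cyl q m v" for u v l b
  proof -
    note U = mx_props[OF u d] and V = mx_props[OF v d]
    have "u i \<le> v i" for i
    proof -
      consider "i < mx u" | "i = mx u" "mx u < mx v" | "i = mx u" "mx u = mx v" | "i > mx u" using le by linarith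
      then show ?thesis
      proof cases
        case 1 then show ?thesis using p le by (auto simp: cyl_def)
      next
        case 2 then show ?thesis using p le by (auto simp: cyl_def)
      next
        case 3
        have "(\<Sum>k\<le>m. u k) = (\<Sum>k<i. u k) + u i" "(\<Sum>k\<le>m. v k) = (\<Sum>k<i. v k) + v i"
          using sum_split_at[of i m u] sum_split_at[of i m v] U V 3 by auto
        moreover have "(\<Sum>k<i. u k) = (\<Sum>k<i. v k)"
          using p 3 by (intro sum.cong) (auto simp: cyl_def)
        ultimately show ?thesis using monoms_sum[OF u] monoms_sum[OF v] by simp
      qed (use U(3) in auto)
    qed
    then have "u i = v i" if "i \<le> m" for i
      using monoms_sum[OF u] monoms_sum[OF v]
      by (intro sum_mono_inv[of u "{..m}" v]) (use that in auto)
    then have "u i = v i" for i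
      using monoms_above[OF u, of i] monoms_above[OF v, of i] by (cases "i \<le> m") auto
    then show False using ne by auto
  qed
  show ?thesis
  proof (rule ccontr)
    assume "cyl q m u \<inter> cyl q m v \<noteq> {}"
    then obtain l b where "(l, b) \<in> cyl q m u" "(l, b) \<in> cyl q m v" by fastforce
    then show False
      using wlog[of u v l b] wlog[of v u l b] u v ne by (cases "mx u \<le> mx v") auto
  qed
qed

lemma finite_lex_max:
  assumes "finite A" "A \<noteq> {}"
  shows "\<exists>u\<in>A. \<forall>v\<in>A. \<not> lex_less u v"
  using assms
proof (induction A rule: finite_ne_induct)
  case (singleton x)
  then show ?case using lex_less_irrefl by auto
next
  case (insert x A)
  then obtain u where u: "u \<in> A" "\<forall>v\<in>A. \<not> lex_less u v" by blast
  show ?case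
  proof (cases "lex_less u x")
    case True
    then have "\<forall>v\<in>A. \<not> lex_less x v" using u(2) lex_less_trans by blast
    then show ?thesis using lex_less_irrefl by auto
  next
    case False
    then show ?thesis using u by auto
  qed
qed

text \<open>Take the lexicographically greatest divisor u in \<open>S\<close> of a point. If some
  b_i exceeded u_i before the last variable of u, stability would exchange a factor of that last
  variable for x_i and give a greater divisor in \<open>S\<close>. So the point repeats u exactly up
  to there.\<close>

lemma up_stable:
  assumes S: "S \<subseteq> monoms m d" "stable m S" and d: "0 < d"
  shows "up q m S = (\<Union>u\<in>S. cyl q m u)"
proof (intro subset_antisym subsetI)
  fix p assume p: "p \<in> up q m S"
  obtain l b where lb: "p = (l, b)" by (cases p)
  let ?A = "{u \<in> S. pdvd u (l, b)}"
  have "?A \<noteq> {}" "finite ?A" using p lb finite_sub_monoms[OF S(1)] by (auto simp: up_def)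
  then obtain u where u: "u \<in> S" "pdvd u (l, b)" and max: "\<And>v. v \<in> S \<Longrightarrow> pdvd v (l, b) \<Longrightarrow> \<not> lex_less u v"
    using finite_lex_max[of ?A] by blast
  have um: "u \<in> monoms m d" using u S by blast
  note M = mx_props[OF um d]
  have Ml: "mx u \<le> l" using M(2) u(2) by (auto simp: pdvd_def not_less[symmetric])
  have "b i = u i" if i: "i < mx u" for i
  proof (rule ccontr)
    assume "b i \<noteq> u i"
    then have lt: "u i < b i" using u(2) i Ml by (auto simp: pdvd_def le_neq_implies_less)
    let ?v = "u(mx u := u (mx u) - 1, i := Suc (u i))"
    have "?v \<in> S" using stableD[OF S(2) u(1) i] M by simp
    moreover have "pdvd ?v (l, b)"
    proof -
      have "?v k \<le> b k" if "k < l" for k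
        using u(2) that lt by (auto simp: pdvd_def intro: le_trans[OF diff_le_self])
      moreover have "?v k = 0" if "k > l" for k using u(2) that i Ml by (auto simp: pdvd_def)
      ultimately show ?thesis by (simp add: pdvd_def)
    qed
    moreover have "lex_less u ?v"
      unfolding lex_less_def using i by (intro exI[of _ i]) auto
    ultimately show False using max by blast
  qed
  then have "p \<in> cyl q m u" using p lb Ml u(2) by (auto simp: cyl_def up_def pdvd_def)
  then show "p \<in> (\<Union>u\<in>S. cyl q m u)" using u(1) by blast
next
  fix p assume "p \<in> (\<Union>u\<in>S. cyl q m u)"
  then obtain u where u: "u \<in> S" "p \<in> cyl q m u" by blast
  obtain l b where lb: "p = (l, b)" by (cases p)
  have um: "u \<in> monoms m d" using u S by blast
  note M = mx_props[OF um d]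
  have "u i \<le> b i" if "i < l" for i
    using u(2) lb M(3)[of i] that by (cases i "mx u" rule: linorder_cases) (auto simp: cyl_def)
  moreover have "u i = 0" if "i > l" for i using u(2) lb M(3)[of i] that by (auto simp: cyl_def)
  ultimately have "pdvd u p" using lb by (simp add: pdvd_def)
  then show "p \<in> up q m S" using u lb by (auto simp: up_def cyl_def)
qed

lemma pp_Suc: "pp q (Suc j) = q * pp q j + 1"
  unfolding pp_def sum.atMost_Suc_shift by (simp add: sum_distrib_left)

text \<open>From (q - 1) p_j + 1 = q^(j+1) and d \<le> q - 1. This makes the weight of every
  monomial of degree d nonnegative.\<close>

lemma pp_mult_le:
  assumes "d < q"
  shows "pp q j * d \<le> q ^ Suc j"
proof -
  have "pp q j * (q - 1) + 1 = q ^ Suc j"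
  proof (induction j)
    case 0
    then show ?case using assms by (simp add: pp_def)
  next
    case (Suc j)
    have "pp q (Suc j) * (q - 1) + 1 = q * (pp q j * (q - 1)) + ((q - 1) + 1)"
      by (simp add: pp_Suc algebra_simps)
    also have "\<dots> = q * (pp q j * (q - 1) + 1)" using assms by (simp add: algebra_simps)
    finally show ?case unfolding Suc by simp
  qed
  moreover have "pp q j * d \<le> pp q j * (q - 1)" using assms by (intro mult_le_mono2) linarith
  ultimately show ?thesis by linarith
qed

lemma sum_powers_pp:
  assumes "k < m"
  shows "(\<Sum>M\<in>{k..<m}. q ^ (m - M)) = q * pp q (m - 1 - k)"
proof -
  have "(\<Sum>M\<in>{k..<m}. q ^ (m - M)) = (\<Sum>i\<le>m - 1 - k. q ^ Suc i)"
    using assms by (intro sum.reindex_bij_witness[of _ "\<lambda>i. m - 1 - i" "\<lambda>M. m - 1 - M"])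
      (auto simp flip: power_Suc simp: Suc_diff_Suc)
  then show ?thesis by (simp add: pp_def sum_distrib_left)
qed

text \<open>\<open>sum_powers_pp\<close> spreads the term containing q over all M from the last
  variable of \<open>u\<close> on, while the correction with u_M survives only at the first of them.
  The condition on M turns into membership in \<open>low M S\<close> once the sum over all u in S is
  taken.\<close>

lemma card_cyl_int:
  assumes u: "u \<in> monoms m d" and d: "0 < d" "d < q"
  shows "int (card (cyl q m u))
    = 1 + (\<Sum>M<m. if \<forall>i>M. u i = 0 then int (q ^ (m - M)) - int (pp q (m - 1 - M)) * int (u M) else 0)"
proof -
  note M = mx_props[OF u d(1)]
  have iff: "(\<forall>i>k. u i = 0) \<longleftrightarrow> mx u \<le> k" for k
    using M by (metis less_nat_zero_code not_le order_le_less_trans)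
  let ?f = "\<lambda>k. int (q ^ (m - k)) - int (pp q (m - 1 - k)) * int (u k)"
  have "(\<Sum>k<m. if \<forall>i>k. u i = 0 then ?f k else 0) = (\<Sum>k\<in>{mx u..<m}. ?f k)"
    unfolding iff by (intro sum.mono_neutral_cong_right) auto
  also have "\<dots> = (if mx u < m then int ((q - u (mx u)) * pp q (m - 1 - mx u)) else 0)"
  proof (cases "mx u < m")
    case True
    have "(\<Sum>k\<in>{mx u..<m}. int (pp q (m - 1 - k)) * int (u k))
        = (\<Sum>k\<in>{mx u}. int (pp q (m - 1 - k)) * int (u k))"
      using True M(3) by (intro sum.mono_neutral_right) auto
    moreover have "(\<Sum>k\<in>{mx u..<m}. int (q ^ (m - k))) = int (q * pp q (m - 1 - mx u))"
      using sum_powers_pp[OF True, of q] by (metis of_nat_sum)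
    moreover have "u (mx u) \<le> q" using monoms_le[OF u, of "mx u"] d by simp
    ultimately show ?thesis using True by (simp add: sum_subtractf of_nat_diff algebra_simps)
  qed auto
  finally show ?thesis using card_cyl[OF u d] by auto
qed

lemma card_up_stable:
  assumes S: "S \<subseteq> monoms m d" "stable m S" and d: "0 < d" "d < q"
  shows "int (card (up q m S)) = int (card S)
    + (\<Sum>M<m. \<Sum>u\<in>low M S. int (q ^ (m - M)) - int (pp q (m - 1 - M)) * int (u M))"
proof -
  let ?f = "\<lambda>M u. int (q ^ (m - M)) - int (pp q (m - 1 - M)) * int (u M)"
  have fin: "finite S" using finite_sub_monoms[OF S(1)] .
  have "card (up q m S) = (\<Sum>u\<in>S. card (cyl q m u))"
    unfolding up_stable[OF S d(1)]
  proof (rule card_UN_disjoint[OF fin])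
    show "\<forall>u\<in>S. finite (cyl q m u)"
      by (auto simp: cyl_def intro: finite_subset[OF _ finite_pts[of q m]])
    show "\<forall>u\<in>S. \<forall>v\<in>S. u \<noteq> v \<longrightarrow> cyl q m u \<inter> cyl q m v = {}"
      using cyl_disjoint[OF _ _ d(1)] S(1) by blast
  qed
  then have "int (card (up q m S)) = (\<Sum>u\<in>S. int (card (cyl q m u)))" by simp
  also have "\<dots> = (\<Sum>u\<in>S. 1 + (\<Sum>M<m. if \<forall>i>M. u i = 0 then ?f M u else 0))"
    using card_cyl_int[OF _ d] S(1) by (intro sum.cong) auto
  also have "\<dots> = int (card S) + (\<Sum>M<m. \<Sum>u\<in>S. if \<forall>i>M. u i = 0 then ?f M u else 0)"
    by (subst sum.distrib, subst sum.swap) simp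
  also have "(\<Sum>M<m. \<Sum>u\<in>S. if \<forall>i>M. u i = 0 then ?f M u else 0) = (\<Sum>M<m. \<Sum>u\<in>low M S. ?f M u)"
    unfolding low_def using fin by (intro sum.cong refl sum.mono_neutral_cong_right) auto
  finally show ?thesis .
qed

text \<open>Each M is compared separately, since restriction to the first variables preserves
  segments and stability. The two sets have equal size, but only an inequality of sizes survives the
  restriction, which is why the weighted comparison allows a smaller segment.\<close>

lemma card_up_lexseg_le:
  assumes S: "S \<subseteq> monoms m d" "stable m S" and L: "lexseg m d L" and card: "card L = card S"
    and d: "0 < d" "d < q"
  shows "card (up q m L) \<le> card (up q m S)"
proof -
  let ?f = "\<lambda>M u. int (q ^ (m - M)) - int (pp q (m - 1 - M)) * int (u M)"
  have Lm: "L \<subseteq> monoms m d" using L by (simp add: lexseg_def)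
  have "(\<Sum>u\<in>low M L. ?f M u) \<le> (\<Sum>u\<in>low M S. ?f M u)" if "M < m" for M
  proof (rule weighted_lexseg_le[of _ _ d])
    show "low M S \<subseteq> monoms M d" using low_monoms[OF S(1)] that by simp
    show "stable M (low M S)" using stable_low[OF S(2)] that by simp
    show "lexseg M d (low M L)" using lexseg_low[OF L] that by simp
    show "card (low M L) \<le> card (low M S)"
      using card_low_lexseg_le[OF S L] card that by simp
    have "pp q (m - 1 - M) * d \<le> q ^ Suc (m - 1 - M)" by (rule pp_mult_le[OF d(2)])
    moreover have "Suc (m - 1 - M) = m - M" using that by simp
    ultimately show "int (pp q (m - 1 - M)) * int d \<le> int (q ^ (m - M))"
      by (metis of_nat_le_iff of_nat_mult)
  qed simp
  then have "(\<Sum>M<m. \<Sum>u\<in>low M L. ?f M u) \<le> (\<Sum>M<m. \<Sum>u\<in>low M S. ?f M u)"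
    by (intro sum_mono) auto
  then show ?thesis
    using card_up_stable[OF S d] card_up_stable[OF Lm lexseg_stable[OF L] d] card by linarith
qed

section \<open>Compression in two adjacent variables\<close>

lemma card_interval_sumset:
  fixes G :: "nat set"
  assumes "finite G" "G \<noteq> {}"
  shows "card G + \<delta> \<le> card {\<alpha>. \<exists>a\<in>G. a \<le> \<alpha> \<and> \<alpha> \<le> a + \<delta>}"
proof -
  have "card G + \<delta> = card (G \<union> {Max G<..Max G + \<delta>})"
    using assms Max_ge by (subst card_Un_disjoint) (fastforce simp: not_less)+
  also have "\<dots> \<le> card {\<alpha>. \<exists>a\<in>G. a \<le> \<alpha> \<and> \<alpha> \<le> a + \<delta>}"
  proof (rule card_mono)
    have "{\<alpha>. \<exists>a\<in>G. a \<le> \<alpha> \<and> \<alpha> \<le> a + \<delta>} \<subseteq> {..Max G + \<delta>}"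
      using assms Max_ge by (fastforce intro: order_trans)
    then show "finite {\<alpha>. \<exists>a\<in>G. a \<le> \<alpha> \<and> \<alpha> \<le> a + \<delta>}" by (rule finite_subset) simp
    show "G \<union> {Max G<..Max G + \<delta>} \<subseteq> {\<alpha>. \<exists>a\<in>G. a \<le> \<alpha> \<and> \<alpha> \<le> a + \<delta>}"
    proof (intro Un_least subsetI)
      fix \<alpha> assume "\<alpha> \<in> {Max G<..Max G + \<delta>}"
      then show "\<alpha> \<in> {\<alpha>. \<exists>a\<in>G. a \<le> \<alpha> \<and> \<alpha> \<le> a + \<delta>}" 
        using Max_in[OF assms] by (auto intro!: bexI[of _ "Max G"])
    qed auto
  qed
  finally show ?thesis .
qed

text \<open>Here \<open>G\<close> stands for the exponents of x_i in a fibre of pair degree k, and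
  \<alpha> for those of multiples of pair degree t; \<open>c\<close> excludes the values for which
  one of the two exponents reaches q. A missed value z splits \<open>G\<close> into
  \<open>GL\<close> and \<open>GR\<close>. The left part can lose only values below c and the right
  part only values above t - c, so each nonempty part covers at least its size plus \<delta> -
  c.\<close>

lemma card_truncated_sumset:
  fixes G :: "nat set"
  assumes G: "G \<subseteq> {..k}" "G \<noteq> {}" and t: "t = k + \<delta>" and c: "c \<le> \<delta>"
    and a0: "Suc k - a0 \<le> card G"
  shows "card {max c a0..t - c} \<le> card {\<alpha> \<in> {c..t - c}. \<exists>a\<in>G. a \<le> \<alpha> \<and> \<alpha> \<le> a + \<delta>}"
    (is "_ \<le> card ?W")
proof (cases "{c..t - c} \<subseteq> ?W")
  case True
  then have "{max c a0..t - c} \<subseteq> ?W" by fastforce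
  then show ?thesis by (intro card_mono) auto
next
  case False
  then obtain z where z: "z \<in> {c..t - c}" "z \<notin> ?W" by blast
  let ?I = "\<lambda>H. {\<alpha>. \<exists>a\<in>H. a \<le> \<alpha> \<and> \<alpha> \<le> a + \<delta>}"
  define GL where "GL = {a \<in> G. a + \<delta> < z}"
  define GR where "GR = {a \<in> G. z < a}"
  have fin: "finite G" using G finite_subset by blast
  have Geq: "G = GL \<union> GR" "GL \<inter> GR = {}" using z by (auto simp: GL_def GR_def not_less)
  have finI: "finite (?I H)" if "H \<subseteq> G" for H
    by (rule finite_subset[of _ "{..k + \<delta>}"]) (use that G in force)+
  have boundL: "card GL + \<delta> - c \<le> card (?I GL - {..<c})" if "GL \<noteq> {}"
  proof -
    have "card (?I GL) - card {..<c} \<le> card (?I GL - {..<c})" by (rule diff_card_le_card_Diff) simp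
    moreover have "card GL + \<delta> \<le> card (?I GL)"
      using card_interval_sumset[of GL \<delta>] that fin by (auto simp: GL_def)
    ultimately show ?thesis by simp
  qed
  have boundR: "card GR + \<delta> - c \<le> card (?I GR - {t - c<..t})" if "GR \<noteq> {}"
  proof -
    have "card (?I GR) - card {t - c<..t} \<le> card (?I GR - {t - c<..t})"
      by (rule diff_card_le_card_Diff) simp
    moreover have "card GR + \<delta> \<le> card (?I GR)"
      using card_interval_sumset[of GR \<delta>] that fin by (auto simp: GR_def)
    moreover have "card {t - c<..t} = c" using t c by simp
    ultimately show ?thesis by simp
  qed
  have sub: "(?I GL - {..<c}) \<union> (?I GR - {t - c<..t}) \<subseteq> ?W"
  proof (intro Un_least subsetI)
    fix \<alpha> assume "\<alpha> \<in> ?I GL - {..<c}"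
    then show "\<alpha> \<in> ?W" using z by (auto simp: GL_def)
  next
    fix \<alpha> assume "\<alpha> \<in> ?I GR - {t - c<..t}"
    then obtain a where a: "a \<in> G" "z < a" "a \<le> \<alpha>" "\<alpha> \<le> a + \<delta>" "\<not> (t - c < \<alpha> \<and> \<alpha> \<le> t)"
      by (auto simp: GR_def)
    moreover have "\<alpha> \<le> t" using a G t by force
    ultimately show "\<alpha> \<in> ?W" using z by auto
  qed
  have disj: "(?I GL - {..<c}) \<inter> (?I GR - {t - c<..t}) = {}"
    by (auto simp: GL_def GR_def)
  have "card (?I GL - {..<c}) + card (?I GR - {t - c<..t})
      = card ((?I GL - {..<c}) \<union> (?I GR - {t - c<..t}))"
    by (rule card_Un_disjoint[symmetric]) (use finI Geq disj in auto)
  also have "\<dots> \<le> card ?W" using sub by (intro card_mono) auto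
  finally have W: "card (?I GL - {..<c}) + card (?I GR - {t - c<..t}) \<le> card ?W" .
  have cardG: "card G = card GL + card GR"
    using Geq fin by (metis card_Un_disjoint finite_Un)
  \<comment> \<open>One nonempty part provides the term \<delta> - c; a second one still contributes
    its own size because c \<le> \<delta>.\<close>
  have "card G + \<delta> - c \<le> card ?W"
  proof (cases "GL = {}")
    case True
    then have "GR \<noteq> {}" using Geq G(2) by auto
    then show ?thesis using boundR W cardG True by simp
  next
    case False
    then show ?thesis using boundL boundR W cardG c by (cases "GR = {}") auto
  qed
  moreover have "card {max c a0..t - c} \<le> Suc k - a0 + \<delta> - c" using t c by (auto simp: max_def)
  ultimately show ?thesis using a0 by linarith
qed

lemma card_le_by_key:
  assumes "finite A" "finite B" "\<And>k. card {x \<in> A. \<kappa> x = k} \<le> card {x \<in> B. \<kappa> x = k}"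
  shows "card A \<le> card B"
proof -
  let ?K = "\<kappa> ` A \<union> \<kappa> ` B"
  have "(\<Sum>k\<in>?K. \<Sum>x\<in>{x \<in> A. \<kappa> x = k}. 1::nat) = (\<Sum>x\<in>A. 1)"
    by (rule sum.group) (use assms in auto)
  moreover have "(\<Sum>k\<in>?K. \<Sum>x\<in>{x \<in> B. \<kappa> x = k}. 1::nat) = (\<Sum>x\<in>B. 1)"
    by (rule sum.group) (use assms in auto)
  moreover have "(\<Sum>k\<in>?K. card {x \<in> A. \<kappa> x = k}) \<le> (\<Sum>k\<in>?K. card {x \<in> B. \<kappa> x = k})"
    by (rule sum_mono) (rule assms(3))
  ultimately show ?thesis by simp
qed

text \<open>Compression replaces the exponent of the second variable by its rank among the elements of S
  that differ from u only in the two variables.\<close>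

definition fib :: "(nat \<Rightarrow> nat) set \<Rightarrow> nat \<Rightarrow> (nat \<Rightarrow> nat) \<Rightarrow> (nat \<Rightarrow> nat) set" where
  "fib S i u = {v \<in> S. \<forall>l. l \<noteq> i \<and> l \<noteq> Suc i \<longrightarrow> v l = u l}"

definition rho :: "(nat \<Rightarrow> nat) set \<Rightarrow> nat \<Rightarrow> (nat \<Rightarrow> nat) \<Rightarrow> nat" where
  "rho S i u = card {v \<in> fib S i u. v (Suc i) < u (Suc i)}"

definition cmp :: "(nat \<Rightarrow> nat) set \<Rightarrow> nat \<Rightarrow> (nat \<Rightarrow> nat) \<Rightarrow> nat \<Rightarrow> nat" where
  "cmp S i u = u(i := u i + u (Suc i) - rho S i u, Suc i := rho S i u)"

text \<open>Potential for the compression: moving a factor from x_(i+1) to x_i lowers it by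
  one.\<close>

definition wt :: "nat \<Rightarrow> (nat \<Rightarrow> nat) \<Rightarrow> nat" where
  "wt m u = (\<Sum>l\<le>m. l * u l)"

lemma sum_split_pair:
  fixes f :: "nat \<Rightarrow> nat"
  assumes "i < m"
  shows "(\<Sum>l\<le>m. f l) = f i + f (Suc i) + (\<Sum>l\<in>{..m} - {i, Suc i}. f l)"
proof -
  have "{..m} = {i, Suc i} \<union> ({..m} - {i, Suc i})" using assms by auto
  then have "(\<Sum>l\<le>m. f l) = (\<Sum>l\<in>{i, Suc i}. f l) + (\<Sum>l\<in>{..m} - {i, Suc i}. f l)"
    by (metis Diff_disjoint finite.emptyI finite_atMost finite_Diff finite_insert sum.union_disjoint)
  then show ?thesis by simp
qed

section \<open>One compression step and the number of multiples\<close>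

locale compression =
  fixes m d i q :: nat and S :: "(nat \<Rightarrow> nat) set"
  assumes S: "S \<subseteq> monoms m d" and i: "i < m" and dq: "d < q"
begin

lemma pair_sum:
  assumes "u \<in> monoms m d" "v \<in> monoms m d" "\<forall>l. l \<noteq> i \<and> l \<noteq> Suc i \<longrightarrow> v l = u l"
  shows "v i + v (Suc i) = u i + u (Suc i)"
proof -
  have "(\<Sum>l\<in>{..m} - {i, Suc i}. v l) = (\<Sum>l\<in>{..m} - {i, Suc i}. u l)"
    using assms(3) by (intro sum.cong) auto
  then show ?thesis
    using sum_split_pair[OF i, of u] sum_split_pair[OF i, of v] monoms_sum[OF assms(1)] monoms_sum[OF assms(2)]
    by linarith
qed

lemma fib_pair_sum: "u \<in> S \<Longrightarrow> v \<in> fib S i u \<Longrightarrow> v i + v (Suc i) = u i + u (Suc i)"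
  using S by (intro pair_sum) (auto simp: fib_def)

lemma fib_eq:
  assumes "u \<in> S" "v \<in> fib S i u"
  shows "v = u(i := v i, Suc i := u i + u (Suc i) - v i)"
proof
  fix l
  show "v l = (u(i := v i, Suc i := u i + u (Suc i) - v i)) l"
    using fib_pair_sum[OF assms] assms(2) by (auto simp: fib_def)
qed

lemma finite_fib: "finite (fib S i u)"
  using finite_sub_monoms[OF S] by (simp add: fib_def)

lemma inj_fib: "u \<in> S \<Longrightarrow> inj_on (\<lambda>v. v (Suc i)) (fib S i u)"
proof (rule inj_onI)
  fix v w assume a: "u \<in> S" "v \<in> fib S i u" "w \<in> fib S i u" "v (Suc i) = w (Suc i)"
  then have "v i = w i" using fib_pair_sum[of u v] fib_pair_sum[of u w] by simp
  then show "v = w" using fib_eq[OF a(1,2)] fib_eq[OF a(1,3)] by simp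
qed

lemma rho_image:
  assumes "u \<in> S"
  shows "rho S i u = card ((\<lambda>v. v (Suc i)) ` {v \<in> fib S i u. v (Suc i) < u (Suc i)})"
  unfolding rho_def
  by (rule card_image[symmetric], rule inj_on_subset[OF inj_fib[OF assms]]) auto

lemma rho_le: "u \<in> S \<Longrightarrow> rho S i u \<le> u (Suc i)"
  using card_mono[of "{..<u (Suc i)}" "(\<lambda>v. v (Suc i)) ` {v \<in> fib S i u. v (Suc i) < u (Suc i)}"]
  by (auto simp: rho_image)

text \<open>If the exchange leaves \<open>S\<close>, the value u_(i+1) - 1 is missing from the
  fibre, so the rank counts at most u_(i+1) - 1 values. This is what makes the potential drop
  strictly.\<close>

lemma rho_less:
  assumes "u \<in> S" "0 < u (Suc i)" "u(Suc i := u (Suc i) - 1, i := Suc (u i)) \<notin> S"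
  shows "rho S i u < u (Suc i)"
proof -
  let ?X = "(\<lambda>v. v (Suc i)) ` {v \<in> fib S i u. v (Suc i) < u (Suc i)}"
  have "u (Suc i) - 1 \<notin> ?X"
  proof
    assume "u (Suc i) - 1 \<in> ?X"
    then obtain v where v: "v \<in> fib S i u" "v (Suc i) = u (Suc i) - 1" by auto
    then have "v i = Suc (u i)" using fib_pair_sum[OF assms(1) v(1)] assms(2) by simp
    then have "v = u(Suc i := u (Suc i) - 1, i := Suc (u i))"
      using v by (auto simp: fib_def fun_eq_iff)
    then show False using v assms(3) by (auto simp: fib_def)
  qed
  then have "?X \<subseteq> {..<u (Suc i) - 1}"
    by (force simp: image_iff intro: le_neq_implies_less)
  then have "card ?X \<le> card {..<u (Suc i) - 1}" by (intro card_mono) auto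
  then show ?thesis using assms by (simp add: rho_image)
qed

lemma cmp_off: "l \<noteq> i \<Longrightarrow> l \<noteq> Suc i \<Longrightarrow> cmp S i u l = u l"
  by (simp add: cmp_def)

lemma cmp_pair: "u \<in> S \<Longrightarrow> cmp S i u i + cmp S i u (Suc i) = u i + u (Suc i)"
  using rho_le[of u] by (simp add: cmp_def)

lemma cmp_monoms:
  assumes "u \<in> S"
  shows "cmp S i u \<in> monoms m d"
proof -
  have "(\<Sum>l\<in>{..m} - {i, Suc i}. cmp S i u l) = (\<Sum>l\<in>{..m} - {i, Suc i}. u l)"
    by (intro sum.cong) (auto simp: cmp_off)
  then have "(\<Sum>l\<le>m. cmp S i u l) = (\<Sum>l\<le>m. u l)"
    using sum_split_pair[OF i, of u] sum_split_pair[OF i, of "cmp S i u"] cmp_pair[OF assms] by linarith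
  moreover have "u \<in> monoms m d" using assms S by blast
  ultimately show ?thesis using i by (auto simp: monoms_def cmp_off)
qed

lemma wt_cmp:
  assumes "u \<in> S"
  shows "wt m (cmp S i u) + (u (Suc i) - rho S i u) = wt m u"
proof -
  have "(\<Sum>l\<in>{..m} - {i, Suc i}. l * cmp S i u l) = (\<Sum>l\<in>{..m} - {i, Suc i}. l * u l)"
    by (intro sum.cong) (auto simp: cmp_off)
  moreover have "i * cmp S i u i + Suc i * cmp S i u (Suc i) + (u (Suc i) - rho S i u) = i * u i + Suc i * u (Suc i)"
  proof -
    have "i * cmp S i u i + Suc i * cmp S i u (Suc i) = i * (u i + u (Suc i)) + rho S i u"
      using cmp_pair[OF assms] by (simp add: cmp_def flip: distrib_left)
    then show ?thesis using rho_le[OF assms] by (simp add: algebra_simps)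
  qed
  ultimately show ?thesis
    unfolding wt_def
    using sum_split_pair[OF i, of "\<lambda>l. l * u l"] sum_split_pair[OF i, of "\<lambda>l. l * cmp S i u l"] by linarith
qed

text \<open>Compression keeps all other exponents, hence the fibre, and the rank is strictly
  increasing within a fibre; the remaining exponent follows from the degree.\<close>

lemma inj_cmp: "inj_on (cmp S i) S"
proof (rule inj_onI)
  fix u v assume u: "u \<in> S" and v: "v \<in> S" and eq: "cmp S i u = cmp S i v"
  have off: "u l = v l" if "l \<noteq> i" "l \<noteq> Suc i" for l
    using fun_cong[OF eq, of l] that by (simp add: cmp_off)
  have fibs: "fib S i u = fib S i v" using off by (auto simp: fib_def)
  have r: "rho S i u = rho S i v" using fun_cong[OF eq, of "Suc i"] by (simp add: cmp_def)
  have lt: "rho S i a < rho S i b" if "a \<in> S" "fib S i a = fib S i b" "a (Suc i) < b (Suc i)" for a b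
  proof -
    have "a \<in> fib S i a" using that(1) by (simp add: fib_def)
    then have "{w \<in> fib S i a. w (Suc i) < a (Suc i)} \<subset> {w \<in> fib S i b. w (Suc i) < b (Suc i)}"
      using that by auto
    then show ?thesis unfolding rho_def using finite_fib by (intro psubset_card_mono) auto
  qed
  have s: "u (Suc i) = v (Suc i)"
    using lt[of u v] lt[of v u] u v fibs r by (cases "u (Suc i)" "v (Suc i)" rule: linorder_cases) auto
  moreover have "u i = v i" using pair_sum[of v u] S u v off s by auto
  ultimately show "u = v" using off by (metis ext)
qed

text \<open>All elements of the fibre share the pair degree \<open>k\<close>. Compression gives
  \<open>u\<close> the x_i-exponent k minus its rank, and the fibre contains \<open>u\<close>
  besides the elements counted by the rank; this is the bound on the size of
  \<open>G\<close>.\<close>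

lemma cmp_fibre:
  assumes u: "u \<in> S"
  defines "k \<equiv> u i + u (Suc i)" and "G \<equiv> (\<lambda>v. v i) ` fib S i u"
  shows "G \<subseteq> {..k}" "G \<noteq> {}" "Suc k - cmp S i u i \<le> card G" "k \<le> d" "cmp S i u i \<le> k"
    "\<And>a. a \<in> G \<Longrightarrow> u(i := a, Suc i := k - a) \<in> S"
proof -
  have self: "u \<in> fib S i u" using u by (simp add: fib_def)
  show "G \<subseteq> {..k}" using fib_pair_sum[OF u] unfolding G_def k_def by fastforce
  show "G \<noteq> {}" using self by (auto simp: G_def)
  have "inj_on (\<lambda>v. v i) (fib S i u)"
  proof (rule inj_onI)
    fix v w assume "v \<in> fib S i u" "w \<in> fib S i u" "v i = w i"
    then show "v = w" using fib_eq[OF u, of v] fib_eq[OF u, of w] by simp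
  qed
  then have cardG: "card G = card (fib S i u)" unfolding G_def by (rule card_image)
  have "Suc (rho S i u) = card (insert u {v \<in> fib S i u. v (Suc i) < u (Suc i)})"
    unfolding rho_def using finite_fib by simp
  also have "\<dots> \<le> card (fib S i u)" using self finite_fib by (intro card_mono) auto
  finally show "Suc k - cmp S i u i \<le> card G"
    using rho_le[OF u] unfolding cardG k_def by (simp add: cmp_def)
  have "k + (\<Sum>l\<in>{..m} - {i, Suc i}. u l) = d"
    using sum_split_pair[OF i, of u] monoms_sum[of u m d] S u by (auto simp: k_def)
  then show "k \<le> d" by simp
  show "cmp S i u i \<le> k" by (simp add: cmp_def k_def)
  fix a assume "a \<in> G"
  then obtain v where v: "v \<in> fib S i u" "a = v i" by (auto simp: G_def)
  then show "u(i := a, Suc i := k - a) \<in> S"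
    using fib_eq[OF u v(1)] v by (auto simp: fib_def k_def)
qed

text \<open>Multiples are compared class by class. The points with last variable x_i have to be merged
  with those with last variable x_(i+1), because compression may increase the number of multiples
  among the former. The points with a later last variable are split further by b_i + b_(i+1).\<close>

definition key :: "nat \<times> (nat \<Rightarrow> nat) \<Rightarrow> nat \<times> (nat \<Rightarrow> nat) \<times> nat" where
  "key = (\<lambda>(l, b). (if l = Suc i then i else l, b(i := 0, Suc i := 0), if Suc i < l then b i + b (Suc i) else 0))"

text \<open>A divisor of such a point involves neither x_i nor x_(i+1), and compression preserves
  the sum of these two exponents.\<close>

lemma pdvd_cmp_small:
  assumes u: "u \<in> S" and l: "l < i" and dv: "pdvd (cmp S i u) (l, b)"
  shows "pdvd u (l, b)"
proof -
  have "cmp S i u i = 0" "cmp S i u (Suc i) = 0" using dv l by (auto simp: pdvd_def)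
  then have "u i = 0" "u (Suc i) = 0" using cmp_pair[OF u] by auto
  moreover have "u k = cmp S i u k" if "k \<noteq> i" "k \<noteq> Suc i" for k using cmp_off[OF that] by simp
  ultimately have "u k \<le> cmp S i u k" for k by (cases "k = i \<or> k = Suc i") auto
  then show ?thesis using dv unfolding pdvd_def by (metis fst_conv snd_conv le_trans le_zero_eq)
qed

text \<open>A class consists of the point (i, \<tau>) and, with x_(i+1) last, one point
  \<open>P \<alpha>\<close> for each x_i-exponent \<alpha>. The compressed set reaches at most (i,
  \<tau>) and the \<open>P \<alpha>\<close> from \<open>a0\<close> on; it remains to find as many
  for \<open>S\<close>.\<close>

lemma up_cmp_adjacent_level:
  "card {x \<in> up q m (cmp S i ` S). key x = (i, \<tau>, t)} \<le> card {x \<in> up q m S. key x = (i, \<tau>, t)}"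
    (is "card ?A \<le> card ?B")
proof (cases "?A = {}")
  case False
  have finB: "finite ?B" by (rule finite_subset[OF _ finite_pts[of q m]]) (auto simp: up_def)
  define R where "R = {u \<in> S. (\<forall>l<i. u l \<le> \<tau> l) \<and> (\<forall>l>Suc i. u l = 0)}"
  define P where "P = (\<lambda>\<alpha>. (Suc i, \<tau>(i := \<alpha>)))"
  have A: "\<exists>w\<in>R. x = (i, \<tau>) \<or> (\<exists>\<alpha><q. x = P \<alpha> \<and> cmp S i w i \<le> \<alpha>)"
    "(\<forall>l<i. \<tau> l < q) \<and> (\<forall>l\<ge>i. \<tau> l = 0) \<and> t = 0" if x: "x \<in> ?A" for x
  proof -
    obtain l b where lb: "x = (l, b)" by (cases x)
    obtain w where w: "w \<in> S" "pdvd (cmp S i w) (l, b)" using x lb by (auto simp: up_def)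
    have l: "l = i \<or> l = Suc i" and \<tau>: "\<tau> = b(i := 0, Suc i := 0)" and t: "t = 0"
      using x lb by (auto simp: key_def split: if_splits)
    have p: "(l, b) \<in> pts q m" using x lb by (auto simp: up_def)
    show "(\<forall>l<i. \<tau> l < q) \<and> (\<forall>l\<ge>i. \<tau> l = 0) \<and> t = 0" using p l \<tau> t by (auto simp: pts_def)
    have wR: "w \<in> R"
    proof -
      have "w k \<le> \<tau> k" if "k < i" for k
      proof -
        have "k < l" using l that by auto
        then have "cmp S i w k \<le> b k" using w(2) by (simp add: pdvd_def)
        then show ?thesis using that by (simp add: \<tau> cmp_off)
      qed
      moreover have "w k = 0" if "k > Suc i" for k
        using w(2) l that cmp_off[of k w] by (auto simp: pdvd_def)
      ultimately show ?thesis using w(1) by (simp add: R_def)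
    qed
    have "x = (i, \<tau>) \<or> (\<exists>\<alpha><q. x = P \<alpha> \<and> cmp S i w i \<le> \<alpha>)"
    proof (cases "l = i")
      case True
      then have "b = \<tau>" using p by (auto simp: \<tau> pts_def fun_eq_iff)
      then show ?thesis using lb True by simp
    next
      case False
      then have l: "l = Suc i" using l by simp
      then have "b = \<tau>(i := b i)" using p by (auto simp: \<tau> pts_def fun_eq_iff)
      moreover have "b i < q" using p l by (auto simp: pts_def)
      moreover have "cmp S i w i \<le> b i" using w(2) l by (auto simp: pdvd_def)
      ultimately show ?thesis using lb l by (auto simp: P_def intro!: exI[of _ "b i"])
    qed
    then show "\<exists>w\<in>R. x = (i, \<tau>) \<or> (\<exists>\<alpha><q. x = P \<alpha> \<and> cmp S i w i \<le> \<alpha>)" using wR by blast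
  qed
  then have "R \<noteq> {}" using False by blast
  \<comment> \<open>Each admissible monomial imposes, after compression, a lower bound on \<alpha>;
    the smallest bound decides.\<close>
  then obtain u where u: "u \<in> R" and least: "\<And>w. w \<in> R \<Longrightarrow> cmp S i u i \<le> cmp S i w i"
    using ex_has_least_nat[of "\<lambda>w. w \<in> R" _ "\<lambda>w. cmp S i w i"] by blast
  have \<tau>: "\<forall>l<i. \<tau> l < q" "\<forall>l\<ge>i. \<tau> l = 0" "t = 0" using A(2) False by blast+
  have uS: "u \<in> S" using u by (simp add: R_def)
  define a0 where "a0 = cmp S i u i"
  define k where "k = u i + u (Suc i)"
  define G where "G = (\<lambda>v. v i) ` fib S i u"
  note G = cmp_fibre[OF uS, folded a0_def k_def G_def]
  have finG: "finite G" using G(1) finite_subset by blast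
  have injP: "inj_on P X" for X by (rule inj_onI) (auto simp: P_def dest: fun_upd_eqD)
  have notP: "(i, \<tau>) \<notin> P ` X" for X by (auto simp: P_def)
  have "?A \<subseteq> insert (i, \<tau>) (P ` {a0..<q})"
  proof
    fix x assume "x \<in> ?A"
    then obtain w where "w \<in> R" "x = (i, \<tau>) \<or> (\<exists>\<alpha><q. x = P \<alpha> \<and> cmp S i w i \<le> \<alpha>)" using A(1) by blast
    then show "x \<in> insert (i, \<tau>) (P ` {a0..<q})" using least[of w] by (auto simp: a0_def)
  qed
  then have "card ?A \<le> card (insert (i, \<tau>) (P ` {a0..<q}))" by (intro card_mono) auto
  also have "\<dots> = Suc (q - a0)" using notP by (simp add: card_image[OF injP])
  finally have cA: "card ?A \<le> Suc (q - a0)" .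
  define a1 where "a1 = Min G"
  have a1: "a1 \<in> G" "\<And>a. a \<in> G \<Longrightarrow> a1 \<le> a" using finG G(2) by (auto simp: a1_def)
  have Gsub: "G \<subseteq> {a1..k}" using a1(2) G(1) by auto
  then have "card G \<le> Suc k - a1" using card_mono[of "{a1..k}" G] by simp
  then have le: "a1 \<le> a0" using G(3,5) by linarith
  have PB: "P ` {a1..<q} \<subseteq> ?B"
  proof
    fix x assume "x \<in> P ` {a1..<q}"
    then obtain \<alpha> where \<alpha>: "a1 \<le> \<alpha>" "\<alpha> < q" "x = P \<alpha>" by auto
    have "x \<in> pts q m" using \<alpha> \<tau> i by (auto simp: P_def pts_def)
    moreover have "pdvd (u(i := a1, Suc i := k - a1)) x"
      using u \<alpha> by (auto simp: P_def pdvd_def R_def less_Suc_eq)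
    moreover have "key x = (i, \<tau>, t)" using \<alpha> \<tau> by (auto simp: P_def key_def fun_eq_iff)
    ultimately show "x \<in> ?B" using G(6)[OF a1(1)] by (auto simp: up_def)
  qed
  \<comment> \<open>If the smallest exponent \<open>a1\<close> in the fibre lies below
    \<open>a0\<close>, the additional point \<open>P a1\<close> compensates for (i, \<tau>).
    Otherwise the size bound forces the fibre to fill the interval up to \<open>k\<close>; it then
    contains a monomial without x_(i+1), which divides (i, \<tau>).\<close>
  show ?thesis
  proof (cases "a1 < a0")
    case True
    have "q - a1 = card (P ` {a1..<q})" by (simp add: card_image[OF injP])
    also have "\<dots> \<le> card ?B" using PB finB by (rule card_mono[rotated])
    finally show ?thesis using cA True G(4,5) dq by linarith
  next
    case False
    then have eq: "a1 = a0" using le by simp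
    have "card {a1..k} \<le> card G" using G(3) eq by simp
    then have "G = {a1..k}" using card_seteq[OF _ Gsub] by simp
    then have "k \<in> G" using a1(1) by auto
    then have "u(i := k, Suc i := k - k) \<in> S" by (rule G(6))
    moreover have "pdvd (u(i := k, Suc i := k - k)) (i, \<tau>)"
      using u by (auto simp: pdvd_def R_def)
    moreover have "(i, \<tau>) \<in> pts q m" using \<tau> i by (auto simp: pts_def)
    moreover have "key (i, \<tau>) = (i, \<tau>, t)" using \<tau> by (auto simp: key_def fun_eq_iff)
    ultimately have "insert (i, \<tau>) (P ` {a1..<q}) \<subseteq> ?B" using PB by (auto simp: up_def)
    then have "card (insert (i, \<tau>) (P ` {a1..<q})) \<le> card ?B" using finB by (rule card_mono[rotated])
    then show ?thesis using cA eq notP by (simp add: card_image[OF injP])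
  qed
qed (simp only: card.empty le0)

text \<open>With the pair degree fixed at \<open>t\<close>, a point of the class is determined by
  its entry \<alpha> at x_i, and the comparison becomes
  \<open>card_truncated_sumset\<close>.\<close>

lemma up_cmp_high_level:
  assumes l: "Suc i < l"
  shows "card {x \<in> up q m (cmp S i ` S). key x = (l, \<tau>, t)} \<le> card {x \<in> up q m S. key x = (l, \<tau>, t)}"
    (is "card ?A \<le> card ?B")
proof (cases "?A = {}")
  case False
  have finB: "finite ?B" by (rule finite_subset[OF _ finite_pts[of q m]]) (auto simp: up_def)
  define R where "R = {u \<in> S. (\<forall>j<l. j \<noteq> i \<and> j \<noteq> Suc i \<longrightarrow> u j \<le> \<tau> j) \<and> (\<forall>j>l. u j = 0) \<and> u i + u (Suc i) \<le> t}"
  define P where "P = (\<lambda>\<alpha>. (l, \<tau>(i := \<alpha>, Suc i := t - \<alpha>)))"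
  \<comment> \<open>Both \<alpha> and t - \<alpha> have to stay below q; truncated subtraction makes
    c equal to 0 as long as t < q.\<close>
  define c where "c = Suc t - q"
  have q0: "0 < q" using dq by simp
  have A: "\<exists>w\<in>R. \<exists>\<alpha>\<in>{c..t - c}. x = P \<alpha> \<and> cmp S i w i \<le> \<alpha>"
    "l \<le> m \<and> (\<forall>j<l. \<tau> j < q) \<and> (\<forall>j\<ge>l. \<tau> j = 0) \<and> \<tau> i = 0 \<and> \<tau> (Suc i) = 0" if x: "x \<in> ?A" for x
  proof -
    obtain l' b where lb: "x = (l', b)" by (cases x)
    have [simp]: "l' = l" and \<tau>: "\<tau> = b(i := 0, Suc i := 0)" and t: "t = b i + b (Suc i)"
      using x lb l by (auto simp: key_def split: if_splits)
    obtain w where w: "w \<in> S" "pdvd (cmp S i w) (l, b)" using x lb by (auto simp: up_def)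
    have p: "(l, b) \<in> pts q m" using x lb by (auto simp: up_def)
    show "l \<le> m \<and> (\<forall>j<l. \<tau> j < q) \<and> (\<forall>j\<ge>l. \<tau> j = 0) \<and> \<tau> i = 0 \<and> \<tau> (Suc i) = 0"
      using p q0 by (auto simp: pts_def \<tau>)
    have bi: "cmp S i w i \<le> b i" "cmp S i w (Suc i) \<le> b (Suc i)" using w(2) l by (auto simp: pdvd_def)
    have wR: "w \<in> R"
    proof -
      have "w j \<le> \<tau> j" if "j < l" "j \<noteq> i" "j \<noteq> Suc i" for j
        using w(2) that cmp_off[of j w] by (auto simp: pdvd_def \<tau>)
      moreover have "w j = 0" if "j > l" for j
        using w(2) l that cmp_off[of j w] by (auto simp: pdvd_def)
      moreover have "w i + w (Suc i) \<le> t" using bi cmp_pair[OF w(1)] t by linarith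
      ultimately show ?thesis using w(1) by (simp add: R_def)
    qed
    have "b i < q" "b (Suc i) < q" using p l by (auto simp: pts_def)
    then have "b i \<in> {c..t - c}" using t by (auto simp: c_def)
    moreover have "x = P (b i)" using lb t by (auto simp: P_def \<tau> fun_eq_iff)
    ultimately show "\<exists>w\<in>R. \<exists>\<alpha>\<in>{c..t - c}. x = P \<alpha> \<and> cmp S i w i \<le> \<alpha>" using wR bi by blast
  qed
  then have "R \<noteq> {}" using False by blast
  then obtain u where u: "u \<in> R" and least: "\<And>w. w \<in> R \<Longrightarrow> cmp S i u i \<le> cmp S i w i"
    using ex_has_least_nat[of "\<lambda>w. w \<in> R" _ "\<lambda>w. cmp S i w i"] by blast
  have \<tau>: "l \<le> m" "\<forall>j<l. \<tau> j < q" "\<forall>j\<ge>l. \<tau> j = 0" "\<tau> i = 0" "\<tau> (Suc i) = 0"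
    using A(2) False by blast+
  have uS: "u \<in> S" using u by (simp add: R_def)
  define a0 where "a0 = cmp S i u i"
  define k where "k = u i + u (Suc i)"
  define G where "G = (\<lambda>v. v i) ` fib S i u"
  note G = cmp_fibre[OF uS, folded a0_def k_def G_def]
  have kt: "k \<le> t" using u by (simp add: R_def k_def)
  have injP: "inj_on P X" for X
  proof (rule inj_onI)
    fix a b assume "P a = P b"
    then have "(\<tau>(i := a, Suc i := t - a)) i = (\<tau>(i := b, Suc i := t - b)) i" by (simp add: P_def)
    then show "a = b" by simp
  qed
  have "?A \<subseteq> P ` {max c a0..t - c}"
  proof
    fix x assume "x \<in> ?A"
    then obtain w \<alpha> where "w \<in> R" "\<alpha> \<in> {c..t - c}" "x = P \<alpha>" "cmp S i w i \<le> \<alpha>" using A(1) by blast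
    then show "x \<in> P ` {max c a0..t - c}" using least[of w] by (auto simp: a0_def)
  qed
  then have "card ?A \<le> card (P ` {max c a0..t - c})" by (intro card_mono) auto
  also have "\<dots> = card {max c a0..t - c}" by (rule card_image[OF injP])
  \<comment> \<open>The condition c \<le> t - k holds because the pair degree k of a fibre is at
    most d < q.\<close>
  also have "\<dots> \<le> card {\<alpha> \<in> {c..t - c}. \<exists>a\<in>G. a \<le> \<alpha> \<and> \<alpha> \<le> a + (t - k)}"
    by (rule card_truncated_sumset[OF G(1,2) _ _ G(3)]) (use kt G(4) dq in \<open>auto simp: c_def\<close>)
  also have "\<dots> = card (P ` {\<alpha> \<in> {c..t - c}. \<exists>a\<in>G. a \<le> \<alpha> \<and> \<alpha> \<le> a + (t - k)})"
    by (rule card_image[OF injP, symmetric])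
  also have "\<dots> \<le> card ?B"
  proof (rule card_mono[OF finB], rule subsetI)
    fix x assume "x \<in> P ` {\<alpha> \<in> {c..t - c}. \<exists>a\<in>G. a \<le> \<alpha> \<and> \<alpha> \<le> a + (t - k)}"
    then obtain \<alpha> a where \<alpha>: "c \<le> \<alpha>" "\<alpha> \<le> t - c" "x = P \<alpha>" and a: "a \<in> G" "a \<le> \<alpha>" "\<alpha> \<le> a + (t - k)"
      by auto
    have "\<alpha> < q" "t - \<alpha> < q" "\<alpha> \<le> t" using \<alpha> q0 by (auto simp: c_def)
    moreover have "k - a \<le> t - \<alpha>" using a G(1) kt by force
    moreover have "x \<in> pts q m" using calculation \<alpha> \<tau> l by (auto simp: P_def pts_def)
    moreover have "pdvd (u(i := a, Suc i := k - a)) x"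
      using u \<alpha>(3) a(2) calculation l by (auto simp: P_def pdvd_def R_def)
    moreover have "key x = (l, \<tau>, t)"
      using \<alpha>(3) \<tau> calculation(3) l by (auto simp: P_def key_def fun_eq_iff)
    ultimately show "x \<in> ?B" using G(6)[OF a(1)] by (auto simp: up_def)
  qed
  finally show ?thesis .
qed (simp only: card.empty le0)

lemma card_up_cmp_le: "card (up q m (cmp S i ` S)) \<le> card (up q m S)"
proof (rule card_le_by_key[of _ _ key])
  show "finite (up q m (cmp S i ` S))" "finite (up q m S)"
    using finite_pts[of q m] by (auto simp: up_def)
  fix k :: "nat \<times> (nat \<Rightarrow> nat) \<times> nat"
  obtain l \<tau> t where k: "k = (l, \<tau>, t)" by (cases k)
  consider "l < i" | "l = i" | "l = Suc i" | "Suc i < l" by linarith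
  then show "card {x \<in> up q m (cmp S i ` S). key x = k} \<le> card {x \<in> up q m S. key x = k}"
  proof cases
    case 1
    have "{x \<in> up q m (cmp S i ` S). key x = k} \<subseteq> {x \<in> up q m S. key x = k}"
    proof
      fix x assume x: "x \<in> {x \<in> up q m (cmp S i ` S). key x = k}"
      obtain l' b where lb: "x = (l', b)" by (cases x)
      have "l' < i" using x lb k 1 by (auto simp: key_def split: if_splits)
      then show "x \<in> {x \<in> up q m S. key x = k}"
        using x lb pdvd_cmp_small[of _ l' b] by (auto simp: up_def)
    qed
    then show ?thesis using finite_pts[of q m] by (intro card_mono) (auto simp: up_def)
  next
    case 2
    then show ?thesis using up_cmp_adjacent_level k by simp
  next
    case 3
    then have "{x \<in> up q m (cmp S i ` S). key x = k} = {}" using k by (auto simp: key_def)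
    then show ?thesis by (simp only: card.empty le0)
  next
    case 4
    then show ?thesis using up_cmp_high_level k by simp
  qed
qed

end

text \<open>A factor is carried from x_j to x_i one variable at a time, so a failure of stability is
  always witnessed by two neighbouring variables.\<close>

lemma stable_if_adjacent:
  assumes adj: "\<And>u i. u \<in> S \<Longrightarrow> i < m \<Longrightarrow> 0 < u (Suc i) \<Longrightarrow> u(Suc i := u (Suc i) - 1, i := Suc (u i)) \<in> S"
  shows "stable m S"
proof -
  have "u(j := u j - 1, i := Suc (u i)) \<in> S" if "u \<in> S" "i < j" "j \<le> m" "0 < u j" for u i j
    using that
  proof (induction j arbitrary: u)
    case (Suc j)
    let ?v = "u(Suc j := u (Suc j) - 1, j := Suc (u j))"
    have v: "?v \<in> S" using adj Suc.prems by simp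
    show ?case
    proof (cases "i = j")
      case True
      then show ?thesis using v by (simp only:)
    next
      case False
      then have "?v(j := ?v j - 1, i := Suc (?v i)) \<in> S" 
        by (intro Suc.IH[OF v]) (use False Suc.prems in auto)
      moreover have "?v(j := ?v j - 1, i := Suc (?v i)) = u(Suc j := u (Suc j) - 1, i := Suc (u i))"
        using False Suc.prems by (auto simp: fun_eq_iff)
      ultimately show ?thesis by (simp only:)
    qed
  qed simp
  then show ?thesis unfolding stable_def by blast
qed

lemma exists_stable:
  assumes "S \<subseteq> monoms m d" "d < q"
  shows "\<exists>T \<subseteq> monoms m d. stable m T \<and> card T = card S \<and> card (up q m T) \<le> card (up q m S)"
  using assms(1)
proof (induction "\<Sum>u\<in>S. wt m u" arbitrary: S rule: less_induct)
  case less
  show ?case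
  proof (cases "stable m S")
    case True
    then show ?thesis using less.prems by blast
  next
    case False
    then obtain u i where u: "u \<in> S" "i < m" "0 < u (Suc i)" "u(Suc i := u (Suc i) - 1, i := Suc (u i)) \<notin> S"
      using stable_if_adjacent by blast
    interpret compression m d i q S using less.prems u assms by unfold_locales
    have fin: "finite S" using finite_sub_monoms[OF less.prems] .
    have "(\<Sum>v\<in>cmp S i ` S. wt m v) = (\<Sum>v\<in>S. wt m (cmp S i v))"
      by (simp add: sum.reindex[OF inj_cmp])
    also have "\<dots> < (\<Sum>v\<in>S. wt m v)"
    proof (rule sum_strict_mono_ex1[OF fin])
      show "\<forall>v\<in>S. wt m (cmp S i v) \<le> wt m v" using wt_cmp by (metis le_add1)
      have "wt m (cmp S i u) < wt m u" using wt_cmp[OF u(1)] rho_less[OF u(1,3,4)] by linarith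
      then show "\<exists>v\<in>S. wt m (cmp S i v) < wt m v" using u(1) by blast
    qed
    finally have less': "(\<Sum>v\<in>cmp S i ` S. wt m v) < (\<Sum>v\<in>S. wt m v)" .
    have "cmp S i ` S \<subseteq> monoms m d" using cmp_monoms by blast
    from less.hyps[OF less' this] obtain T where T: "T \<subseteq> monoms m d" "stable m T" "card T = card (cmp S i ` S)"
        "card (up q m T) \<le> card (up q m (cmp S i ` S))"
      by blast
    show ?thesis
      using T(1,2,3) order_trans[OF T(4) card_up_cmp_le] card_image[OF inj_cmp]
      by (intro exI[of _ T]) simp
  qed
qed

theorem card_up_lexseg_min:
  assumes "S \<subseteq> monoms m d" "lexseg m d L" "card L = card S" "0 < d" "d < q"
  shows "card (up q m L) \<le> card (up q m S)"
proof -
  obtain T where T: "T \<subseteq> monoms m d" "stable m T" "card T = card S" "card (up q m T) \<le> card (up q m S)"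
    using exists_stable[OF assms(1,5)] by blast
  have "card (up q m L) \<le> card (up q m T)"
    using card_up_lexseg_le[OF T(1,2) assms(2) _ assms(4,5)] T(3) assms(3) by simp
  then show ?thesis using T(4) by simp
qed

section \<open>The maximum for large degree\<close>

text \<open>Realises the infinite exponent in degree e: x_l receives all degree that
  \<open>b\<close> leaves.\<close>

definition lift :: "nat \<Rightarrow> nat \<times> (nat \<Rightarrow> nat) \<Rightarrow> nat \<Rightarrow> nat" where
  "lift e = (\<lambda>(l, b). b(l := e - (\<Sum>i<l. b i)))"

context
  fixes q m d e :: nat
  assumes q: "d < q" and d: "0 < d" and e: "m * (q - 1) + d \<le> e"
begin

text \<open>At most m variables precede x_l, each with exponent at most q - 1. The bound on
  \<open>e\<close> thus leaves x_l an exponent of at least d, enough for every divisor of degree d;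
  this is the origin of the threshold e0.\<close>

lemma pts_sum_le:
  assumes "(l, b) \<in> pts q m"
  shows "(\<Sum>i<l. b i) + d \<le> e"
proof -
  have "b i \<le> q - 1" if "i < l" for i
  proof -
    have "b i < q" using assms that by (auto simp: pts_def)
    then show ?thesis by simp
  qed
  then have "(\<Sum>i<l. b i) \<le> l * (q - 1)"
    using sum_bounded_above[of "{..<l}" b "q - 1"] by simp
  also have "\<dots> \<le> m * (q - 1)" using assms by (intro mult_le_mono1) (simp add: pts_def)
  finally show ?thesis using e by linarith
qed

lemma mx_lift:
  assumes "(l, b) \<in> pts q m"
  shows "mx (lift e (l, b)) = l"
  using pts_sum_le[OF assms] d assms by (intro mx_eqI) (auto simp: lift_def pts_def)

lemma inj_lift: "inj_on (lift e) (pts q m)"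
proof (rule inj_onI)
  fix x y assume x: "x \<in> pts q m" and y: "y \<in> pts q m" and eq: "lift e x = lift e y"
  obtain l b l' b' where lb: "x = (l, b)" "y = (l', b')" by (cases x; cases y)
  have ll: "l = l'" using mx_lift[of l b] mx_lift[of l' b'] x y lb eq by simp
  have "b i = b' i" for i
  proof (cases "i = l")
    case True
    then show ?thesis using x y lb ll by (auto simp: pts_def)
  next
    case False
    then show ?thesis using fun_cong[OF eq, of i] lb ll by (simp add: lift_def)
  qed
  then show "x = y" using lb ll by auto
qed

lemma lift_image: "lift e ` pts q m = red_monos q m e"
proof (intro subset_antisym subsetI)
  fix a assume "a \<in> lift e ` pts q m"
  then obtain l b where lb: "(l, b) \<in> pts q m" "a = lift e (l, b)" by auto
  have lm: "l \<le> m" using lb by (simp add: pts_def)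
  have "(\<Sum>i\<le>m. a i) = (\<Sum>i<l. a i) + a l + (\<Sum>i\<in>{l<..m}. a i)" by (rule sum_split_at[OF lm])
  also have "(\<Sum>i<l. a i) = (\<Sum>i<l. b i)" using lb by (intro sum.cong) (auto simp: lift_def)
  also have "(\<Sum>i\<in>{l<..m}. a i) = 0" using lb by (intro sum.neutral) (auto simp: lift_def pts_def)
  also have "a l = e - (\<Sum>i<l. b i)" using lb by (simp add: lift_def)
  finally have "(\<Sum>i\<le>m. a i) = e" using pts_sum_le[OF lb(1)] by simp
  then have "a \<in> monoms m e" using lb lm by (auto simp: monoms_def lift_def pts_def)
  moreover have "proj_reduced q a"
  proof -
    have "a i \<le> q - 1" if "i < l" for i
    proof -
      have "b i < q" using lb that by (auto simp: pts_def)
      then show ?thesis using lb that by (simp add: lift_def)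
    qed
    moreover have "Max {i. 0 < a i} = l" using mx_lift[OF lb(1)] lb(2) by (simp add: mx_def)
    ultimately show ?thesis unfolding proj_reduced_def by simp
  qed
  ultimately show "a \<in> red_monos q m e" by (simp add: red_monos_def)
next
  fix a assume a: "a \<in> red_monos q m e"
  then have am: "a \<in> monoms m e" by (simp add: red_monos_def)
  have e0: "0 < e" using e d by simp
  note M = mx_props[OF am e0]
  have "a \<noteq> (\<lambda>_. 0)" using M(2) by auto
  then have "\<forall>i<mx a. a i \<le> q - 1" using a by (auto simp: red_monos_def proj_reduced_def mx_def)
  then have le: "a i \<le> q - 1" if "i < mx a" for i using that by blast
  have lt: "a i < q" if "i < mx a" for i using le[OF that] q by linarith
  have "(mx a, a(mx a := 0)) \<in> pts q m" using M lt by (auto simp: pts_def)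
  moreover have "lift e (mx a, a(mx a := 0)) = a"
  proof -
    have "(\<Sum>i\<le>m. a i) = (\<Sum>i<mx a. a i) + a (mx a) + (\<Sum>i\<in>{mx a<..m}. a i)"
      by (rule sum_split_at[OF M(1)])
    also have "(\<Sum>i\<in>{mx a<..m}. a i) = 0" using M(3) by (intro sum.neutral) auto
    finally have "e - (\<Sum>i<mx a. a i) = a (mx a)" using monoms_sum[OF am] by simp
    moreover have "(\<Sum>i<mx a. (a(mx a := 0)) i) = (\<Sum>i<mx a. a i)" by (intro sum.cong) auto
    ultimately show ?thesis by (simp add: lift_def)
  qed
  ultimately show "a \<in> lift e ` pts q m" by (metis image_eqI)
qed

lemma mono_dvd_lift:
  assumes u: "u \<in> monoms m d" and p: "(l, b) \<in> pts q m"
  shows "mono_dvd u (lift e (l, b)) \<longleftrightarrow> pdvd u (l, b)"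
proof
  assume dv: "mono_dvd u (lift e (l, b))"
  have "u i \<le> b i" if "i \<noteq> l" for i
    using dv that unfolding mono_dvd_def lift_def by (metis case_prod_conv fun_upd_other)
  then show "pdvd u (l, b)" using p by (fastforce simp: pdvd_def pts_def)
next
  assume dv: "pdvd u (l, b)"
  have "u i \<le> lift e (l, b) i" for i
  proof (cases i l rule: linorder_cases)
    case equal
    then show ?thesis using monoms_le[OF u, of l] pts_sum_le[OF p] by (simp add: lift_def)
  qed (use dv in \<open>auto simp: pdvd_def lift_def\<close>)
  then show "mono_dvd u (lift e (l, b))" by (simp add: mono_dvd_def)
qed

lemma card_Delta:
  assumes "S \<subseteq> monoms m d"
  shows "card (Delta q m e S) = card (pts q m - up q m S)"
proof -
  have iff: "(\<exists>u\<in>S. mono_dvd u (lift e x)) \<longleftrightarrow> (\<exists>u\<in>S. pdvd u x)" if "x \<in> pts q m" for x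
    using mono_dvd_lift[of _ "fst x" "snd x"] that assms by auto
  have "Delta q m e S = lift e ` (pts q m - up q m S)"
    unfolding Delta_def nabla_def lift_image[symmetric] up_def using iff by auto
  then show ?thesis
    using card_image[OF inj_on_subset[OF inj_lift, of "pts q m - up q m S"]] by simp
qed

text \<open>Exponents are at most d \<le> q - 1, so \<open>A_fun\<close> ranges over all r-element
  sets of monomials of degree d.\<close>

lemma red_monos_low_degree: "red_monos q m d = monoms m d"
proof -
  have "proj_reduced q a" if "a \<in> monoms m d" for a
  proof -
    have "a i \<le> q - 1" for i using monoms_le[OF that, of i] q by linarith
    then show ?thesis unfolding proj_reduced_def by blast
  qed
  then show ?thesis by (auto simp: red_monos_def)
qed

lemma card_Delta_le_K:
  assumes S: "S \<subseteq> monoms m d" "card S = r" and r: "1 \<le> r" "r \<le> (m + d) choose m"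
  shows "card (Delta q m e S) \<le> K_fun q r d m"
proof -
  let ?a = "lex_nth r d m"
  let ?L = "lex_ge m d ?a"
  have "card (up q m ?L) \<le> card (up q m S)"
    using card_up_lexseg_min[OF S(1) lexseg_lex_ge _ d q] card_lex_ge_lex_nth[OF r] S(2) by simp
  moreover have "up q m T \<subseteq> pts q m" for T by (auto simp: up_def)
  then have "card (pts q m - up q m T) = card (pts q m) - card (up q m T)" for T
    by (intro card_Diff_subset) (use finite_subset[OF _ finite_pts] in blast)+
  ultimately have "card (pts q m - up q m S) \<le> card (pts q m - up q m ?L)"
    by (simp add: diff_le_mono2)
  then show ?thesis
    using card_Delta[OF S(1)] card_lex_ge_complement[OF lex_nth_props(1)[OF r] q] by (simp add: K_fun_def)
qed

lemma A_fun_eq_K: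
  assumes r: "1 \<le> r" "r \<le> (m + d) choose m"
  shows "A_fun q r d m e = K_fun q r d m"
  unfolding A_fun_def red_monos_low_degree
proof (rule Max_eqI)
  let ?L = "lex_ge m d (lex_nth r d m)"
  show "y \<le> K_fun q r d m" if "y \<in> {card (Delta q m e S) |S. S \<subseteq> monoms m d \<and> card S = r}" for y
    using that card_Delta_le_K r by blast
  then show "finite {card (Delta q m e S) |S. S \<subseteq> monoms m d \<and> card S = r}"
    by (meson finite_nat_set_iff_bounded_le)
  have "?L \<subseteq> monoms m d" by (auto simp: lex_ge_def)
  moreover have "card (Delta q m e ?L) = K_fun q r d m"
    using card_Delta[OF calculation] card_lex_ge_complement[OF lex_nth_props(1)[OF r] q]
    by (simp add: K_fun_def)
  ultimately show "K_fun q r d m \<in> {card (Delta q m e S) |S. S \<subseteq> monoms m d \<and> card S = r}"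
    using card_lex_ge_lex_nth[OF r] by (auto intro!: exI[of _ ?L])
qed

end

section \<open>The projective footprint bound\<close>

definition mon :: "nat \<Rightarrow> (nat \<Rightarrow> nat) \<Rightarrow> (nat \<Rightarrow> 'a::field) \<Rightarrow> 'a" where
  "mon m u x = (\<Prod>i\<le>m. x i ^ u i)"

text \<open>Forms are taken as functions: only their values matter here, and closure under products
  follows by induction without handling coefficients.\<close>

inductive_set forms :: "nat \<Rightarrow> nat \<Rightarrow> ((nat \<Rightarrow> 'a::field) \<Rightarrow> 'a) set" for m e where
  mon: "u \<in> monoms m e \<Longrightarrow> mon m u \<in> forms m e"
| zero: "(\<lambda>_. 0) \<in> forms m e"
| add: "f \<in> forms m e \<Longrightarrow> g \<in> forms m e \<Longrightarrow> (\<lambda>x. f x + g x) \<in> forms m e"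
| smult: "f \<in> forms m e \<Longrightarrow> (\<lambda>x. c * f x) \<in> forms m e"

lemma mon_add: "mon m (\<lambda>i. u i + v i) x = mon m u x * mon m v x"
  by (simp add: mon_def power_add prod.distrib)

lemma monoms_add: "u \<in> monoms m d \<Longrightarrow> v \<in> monoms m e \<Longrightarrow> (\<lambda>i. u i + v i) \<in> monoms m (d + e)"
  by (auto simp: monoms_def sum.distrib)

lemma forms_mult:
  assumes "f \<in> forms m d" "g \<in> forms m e"
  shows "(\<lambda>x. f x * g x) \<in> forms m (d + e)"
  using assms(1)
proof induction
  case (mon u)
  show ?case using assms(2)
  proof induction
    case (mon v)
    then show ?case
      using forms.mon[OF monoms_add[OF \<open>u \<in> monoms m d\<close> mon]] by (simp add: mon_add[abs_def])
  next
    case zero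
    then show ?case by (simp add: forms.zero)
  next
    case (add f g)
    then show ?case using forms.add[of "\<lambda>x. mon m u x * f x"] by (simp add: distrib_left)
  next
    case (smult f c)
    then show ?case using forms.smult[of "\<lambda>x. mon m u x * f x" m _ c] by (simp add: mult.left_commute)
  qed
next
  case zero
  then show ?case by (simp add: forms.zero)
next
  case (add f g')
  then show ?case using forms.add[of "\<lambda>x. f x * g x"] by (simp add: distrib_right)
next
  case (smult f c)
  then show ?case using forms.smult[of "\<lambda>x. f x * g x" m _ c] by (simp add: mult.assoc)
qed

lemma forms_one: "(\<lambda>_. 1) \<in> forms m 0"
  using forms.mon[of "\<lambda>_. 0" m 0] by (simp add: monoms_0 mon_def[abs_def])

lemma forms_coord:
  assumes "i \<le> m"
  shows "(\<lambda>x :: nat \<Rightarrow> 'a::field. x i) \<in> forms m 1"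
proof -
  have eq: "mon m ((\<lambda>_. 0)(i := 1)) = (\<lambda>x :: nat \<Rightarrow> 'a. x i)"
  proof
    fix x :: "nat \<Rightarrow> 'a"
    have "mon m ((\<lambda>_. 0)(i := 1)) x = (\<Prod>j\<le>m. if j = i then x j else 1)"
      unfolding mon_def by (intro prod.cong) auto
    then show "mon m ((\<lambda>_. 0)(i := 1)) x = x i" using assms by simp
  qed
  have "(\<lambda>_. 0)(i := 1) \<in> monoms m 1"
    using assms monoms_inc[of "\<lambda>_. 0" m 0 i] by (simp add: monoms_0)
  from forms.mon[OF this, where 'a = 'a] show ?thesis unfolding eq .
qed

lemma forms_power: "f \<in> forms m k \<Longrightarrow> (\<lambda>x. f x ^ n) \<in> forms m (n * k)"
proof (induction n)
  case 0
  then show ?case by (simp add: forms_one)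
next
  case (Suc n)
  then show ?case using forms_mult[of f m k "\<lambda>x. f x ^ n" "n * k"] by simp
qed

lemma forms_prod:
  assumes "finite I" "\<And>i. i \<in> I \<Longrightarrow> f i \<in> forms m k"
  shows "(\<lambda>x. \<Prod>i\<in>I. f i x) \<in> forms m (card I * k)"
  using assms
proof (induction I rule: finite_induct)
  case empty
  then show ?case by (simp add: forms_one)
next
  case (insert i I)
  then show ?case using forms_mult[of "f i" m k "\<lambda>x. \<Prod>i\<in>I. f i x" "card I * k"] by simp
qed

lemma forms_sum:
  assumes "finite I" "\<And>i. i \<in> I \<Longrightarrow> f i \<in> forms m k"
  shows "(\<lambda>x. \<Sum>i\<in>I. f i x) \<in> forms m k"
  using assms
proof (induction I rule: finite_induct)
  case empty
  then show ?case by (simp add: forms.zero)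
next
  case (insert i I)
  then show ?case using forms.add[of "f i" m k "\<lambda>x. \<Sum>i\<in>I. f i x"] by simp
qed

lemma finite_field_power:
  fixes x :: "'a::{field,finite}"
  assumes "x \<noteq> 0"
  shows "x ^ (card (UNIV :: 'a set) - 1) = 1"
proof -
  let ?U = "UNIV - {0 :: 'a}"
  have "(\<Prod>y\<in>?U. y) = (\<Prod>y\<in>?U. x * y)"
    by (rule prod.reindex_bij_witness[of _ "\<lambda>y. x * y" "\<lambda>y. y / x"]) (use assms in auto)
  also have "\<dots> = x ^ card ?U * (\<Prod>y\<in>?U. y)" by (simp add: prod.distrib)
  finally have "x ^ card ?U = 1" by simp
  then show ?thesis by (simp add: card_Diff_subset)
qed

lemma finite_field_power_add:
  fixes x :: "'a::{field,finite}"
  assumes "0 < n"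
  shows "x ^ (n + (card (UNIV :: 'a set) - 1)) = x ^ n"
proof (cases "x = 0")
  case False
  then show ?thesis using finite_field_power[OF False] by (simp add: power_add)
qed (use assms in \<open>simp add: zero_power\<close>)

text \<open>Put k = q - 1 and choose l with x_l \<noteq> 0. The factor y_l^k - (y_i - (x_i / x_l)
  y_l)^k is 1 at x, and it is 1 - 1 = 0 whenever y_l \<noteq> 0 and y_i differs from (x_i / x_l)
  y_l. The product over i \<noteq> l has degree m k, and a positive power of y_l removes the points
  with y_l = 0; hence the strict bound on e.\<close>

lemma exists_separating_form:
  fixes x :: "nat \<Rightarrow> 'a::{field,finite}"
  assumes x: "x \<in> vecs m - {\<lambda>_. 0}" and e: "m * (card (UNIV :: 'a set) - 1) < e"
    and q: "1 < card (UNIV :: 'a set)"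
  shows "\<exists>f \<in> forms m e. f x \<noteq> 0 \<and> (\<forall>y \<in> vecs m. f y \<noteq> 0 \<longrightarrow> (\<exists>c. c \<noteq> 0 \<and> y = (\<lambda>i. c * x i)))"
proof -
  define k where "k = card (UNIV :: 'a set) - 1"
  have k: "0 < k" using q by (simp add: k_def)
  have pow: "a ^ k = 1" if "a \<noteq> 0" for a :: 'a using finite_field_power[OF that] by (simp add: k_def)
  have "\<exists>l. x l \<noteq> 0" using x by auto
  then obtain l where l: "x l \<noteq> 0" by blast
  have lm: "l \<le> m" using x l by (auto simp: vecs_def not_less[symmetric])
  define g where "g = (\<lambda>i y. y l ^ k + (- 1) * (y i + (- (x i / x l)) * y l) ^ k)"
  define f where "f = (\<lambda>y. y l ^ (e - m * k) * (\<Prod>i\<in>{..m} - {l}. g i y))"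
  have gf: "g i \<in> forms m k" if "i \<le> m" for i
  proof -
    have lin: "(\<lambda>y. y i + (- (x i / x l)) * y l) \<in> forms m 1"
      by (intro forms.add forms.smult forms_coord that lm)
    have "(\<lambda>y. (y i + (- (x i / x l)) * y l) ^ k) \<in> forms m k"
      using forms_power[OF lin, of k] by simp
    moreover have "(\<lambda>y. y l ^ k) \<in> forms m k" using forms_power[OF forms_coord[OF lm], of k] by simp
    ultimately show ?thesis unfolding g_def by (intro forms.add forms.smult)
  qed
  have "(\<lambda>y. \<Prod>i\<in>{..m} - {l}. g i y) \<in> forms m (m * k)"
    using forms_prod[of "{..m} - {l}" g m k] gf lm by simp
  moreover have "(\<lambda>y. y l ^ (e - m * k)) \<in> forms m (e - m * k)"
    using forms_power[OF forms_coord[OF lm], of "e - m * k"] by simp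
  ultimately have "f \<in> forms m (e - m * k + m * k)" unfolding f_def by (intro forms_mult)
  then have ff: "f \<in> forms m e" using e by (simp add: k_def)
  have "g i x = 1" for i using k l by (simp add: g_def pow zero_power)
  then have fx: "f x \<noteq> 0" using l by (simp add: f_def)
  have "\<exists>c. c \<noteq> 0 \<and> y = (\<lambda>i. c * x i)" if y: "y \<in> vecs m" "f y \<noteq> 0" for y
  proof -
    have "e - m * k > 0" using e by (simp add: k_def)
    then have yl: "y l \<noteq> 0" using y(2) by (auto simp: f_def)
    have "y i = y l / x l * x i" for i
    proof (cases "i \<le> m")
      case True
      show ?thesis
      proof (rule ccontr)
        assume ne: "y i \<noteq> y l / x l * x i"
        then have "i \<noteq> l" using l by auto
        have "y i + (- (x i / x l)) * y l \<noteq> 0" using ne by (simp add: field_simps)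
        then have "g i y = 0" using pow yl by (simp add: g_def)
        then have "f y = 0" using True \<open>i \<noteq> l\<close> unfolding f_def by (auto intro!: prod_zero)
        then show False using y(2) by simp
      qed
    next
      case False
      then show ?thesis using x y(1) by (simp add: vecs_def)
    qed
    then have "y = (\<lambda>i. y l / x l * x i)" by (rule ext)
    moreover have "y l / x l \<noteq> 0" using yl l by simp
    ultimately show ?thesis by blast
  qed
  then show ?thesis using ff fx by blast
qed

section \<open>Reduction of monomials on the common zeros\<close>

definition mspan :: "nat \<Rightarrow> (nat \<Rightarrow> nat) set \<Rightarrow> (nat \<Rightarrow> 'a::field) set \<Rightarrow> ((nat \<Rightarrow> 'a) \<Rightarrow> 'a) set" where
  "mspan m D X = {h. \<exists>c. \<forall>x\<in>X. h x = (\<Sum>u\<in>D. c u * mon m u x)}"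

lemma mspan_mon:
  assumes "u \<in> D" "finite D"
  shows "mon m u \<in> mspan m D X"
proof -
  have "(\<Sum>v\<in>D. (if v = u then 1 else 0) * mon m v x) = mon m u x" for x :: "nat \<Rightarrow> 'a"
    using assms by (subst sum.remove[of _ u]) auto
  then show ?thesis unfolding mspan_def by (intro CollectI exI[of _ "\<lambda>v. if v = u then 1 else 0"]) simp
qed

lemma mspan_zero: "(\<lambda>_. 0) \<in> mspan m D X"
  unfolding mspan_def by (intro CollectI exI[of _ "\<lambda>_. 0"]) simp

lemma mspan_add:
  assumes "f \<in> mspan m D X" "g \<in> mspan m D X"
  shows "(\<lambda>x. f x + g x) \<in> mspan m D X"
proof -
  obtain c c' where "\<forall>x\<in>X. f x = (\<Sum>u\<in>D. c u * mon m u x)" "\<forall>x\<in>X. g x = (\<Sum>u\<in>D. c' u * mon m u x)"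
    using assms by (auto simp: mspan_def)
  then show ?thesis unfolding mspan_def
    by (intro CollectI exI[of _ "\<lambda>u. c u + c' u"]) (simp add: distrib_right sum.distrib)
qed

lemma mspan_smult:
  assumes "f \<in> mspan m D X"
  shows "(\<lambda>x. a * f x) \<in> mspan m D X"
proof -
  obtain c where "\<forall>x\<in>X. f x = (\<Sum>u\<in>D. c u * mon m u x)" using assms by (auto simp: mspan_def)
  then show ?thesis unfolding mspan_def
    by (intro CollectI exI[of _ "\<lambda>u. a * c u"]) (simp add: sum_distrib_left mult.assoc)
qed

lemma mspan_sum:
  assumes "finite I" "\<And>i. i \<in> I \<Longrightarrow> f i \<in> mspan m D X"
  shows "(\<lambda>x. \<Sum>i\<in>I. f i x) \<in> mspan m D X"
  using assms
proof (induction I rule: finite_induct)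
  case empty
  then show ?case by (simp add: mspan_zero)
next
  case (insert i I)
  then show ?case using mspan_add[of "f i" m D X "\<lambda>x. \<Sum>i\<in>I. f i x"] by simp
qed

lemma mspan_cong: "f \<in> mspan m D X \<Longrightarrow> (\<And>x. x \<in> X \<Longrightarrow> g x = f x) \<Longrightarrow> g \<in> mspan m D X"
  unfolding mspan_def by auto

definition is_lead :: "nat \<Rightarrow> nat \<Rightarrow> (nat \<Rightarrow> nat) \<Rightarrow> ((nat \<Rightarrow> nat) \<Rightarrow> 'a::field) \<Rightarrow> bool" where
  "is_lead m d \<nu> g \<longleftrightarrow> \<nu> \<in> monoms m d \<and> g \<nu> \<noteq> 0 \<and> (\<forall>w\<in>monoms m d. g w \<noteq> 0 \<longrightarrow> w = \<nu> \<or> lex_less w \<nu>)"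

text \<open>x_i^q x_j and x_i x_j^q agree as functions. Since u_i is at least q, the exponent left
  at x_i is still positive, so the identity also holds where x_i = 0.\<close>

lemma mon_nonreduced:
  fixes x :: "nat \<Rightarrow> 'a::{field,finite}"
  assumes "i < j" "j \<le> m" "card (UNIV :: 'a set) \<le> u i" "0 < u j"
  defines "k \<equiv> card (UNIV :: 'a set) - 1"
  shows "mon m (u(i := u i - k, j := u j + k)) x = mon m u x"
  unfolding mon_def
proof (rule prod.cong[OF refl])
  fix l
  have "x i ^ (u i - k) = x i ^ u i"
  proof -
    have "0 < card (UNIV :: 'a set)" by (simp add: card_gt_0_iff)
    then have "0 < u i - k" "k \<le> u i" using assms(3) by (auto simp: k_def)
    then show ?thesis using finite_field_power_add[of "u i - k" "x i"] by (simp add: k_def)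
  qed
  moreover have "x j ^ (u j + k) = x j ^ u j"
    using finite_field_power_add[OF assms(4), of "x j"] by (simp add: k_def)
  ultimately show "x l ^ (u(i := u i - k, j := u j + k)) l = x l ^ u l" by simp
qed

text \<open>Induction on the number of monomials lexicographically below. Both rewritings go down:
  moving q - 1 from x_i to a later variable, and replacing a leading monomial by the other terms of
  a form vanishing on \<open>X\<close>, since multiplication by a common monomial preserves the
  order.\<close>

lemma mon_in_mspan_Delta:
  fixes X :: "(nat \<Rightarrow> 'a::{field,finite}) set"
  assumes q: "q = card (UNIV :: 'a set)"
    and S: "\<And>\<nu>. \<nu> \<in> S \<Longrightarrow> \<exists>g. is_lead m d \<nu> g \<and> (\<forall>x\<in>X. peval m d g x = 0)"
    and e: "0 < e" and u: "u \<in> monoms m e"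
  shows "mon m u \<in> mspan m (Delta q m e S) X"
  using u
proof (induction "card {v \<in> monoms m e. lex_less v u}" arbitrary: u rule: less_induct)
  case less
  let ?D = "Delta q m e S"
  have finD: "finite ?D" by (rule finite_subset[OF _ finite_monoms[of m e]]) (auto simp: Delta_def red_monos_def)
  have IH: "mon m v \<in> mspan m ?D X" if v: "v \<in> monoms m e" "lex_less v u" for v
  proof (rule less.hyps[OF _ v(1)], rule psubset_card_mono)
    have "{w \<in> monoms m e. lex_less w v} \<subseteq> {w \<in> monoms m e. lex_less w u}"
      using v(2) lex_less_trans by blast
    then show "{w \<in> monoms m e. lex_less w v} \<subset> {w \<in> monoms m e. lex_less w u}"
      using v lex_less_irrefl by blast
  qed (simp add: finite_monoms)
  consider "u \<in> ?D" | "u \<notin> red_monos q m e" | "u \<in> nabla q m e S" by (auto simp: Delta_def)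
  then show ?case
  proof cases
    case 1
    then show ?thesis using mspan_mon finD by blast
  next
    case 2
    then have np: "\<not> proj_reduced q u" using less.prems by (simp add: red_monos_def)
    define j where "j = mx u"
    note M = mx_props[OF less.prems e, folded j_def]
    obtain i where i: "i < j" "\<not> u i \<le> q - 1" using np by (auto simp: proj_reduced_def j_def mx_def)
    then have ui: "q \<le> u i" by linarith
    have q0: "0 < q" using q by (simp add: card_gt_0_iff)
    let ?v = "u(i := u i - (q - 1), j := u j + (q - 1))"
    have less': "lex_less ?v u" unfolding lex_less_def
    proof (rule exI[of _ i], intro conjI allI impI)
      have "1 < q"
      proof -
        have "card {0, 1 :: 'a} \<le> q" unfolding q by (rule card_mono) auto
        then show ?thesis by simp
      qed
      then show "?v i < u i" using i ui by simp
    qed (use i in auto)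
    have "(\<Sum>l\<le>m. ?v l) = (\<Sum>l\<le>m. u l)"
    proof -
      have "(\<Sum>l\<le>m. (u(i := u i - (q - 1))) l) + u i = (\<Sum>l\<le>m. u l) + (u i - (q - 1))"
        by (rule sum_fun_upd_nat) (use i M(1) in simp)
      moreover have "(\<Sum>l\<le>m. ?v l) + (u(i := u i - (q - 1))) j
          = (\<Sum>l\<le>m. (u(i := u i - (q - 1))) l) + (u j + (q - 1))"
        by (rule sum_fun_upd_nat) (use M(1) in simp)
      moreover have "(u(i := u i - (q - 1))) j = u j" using i by simp
      ultimately show ?thesis using ui q0 by linarith
    qed
    then have "?v \<in> monoms m e" using less.prems i M(1) by (auto simp: monoms_def)
    from IH[OF this less'] show ?thesis
    proof (rule mspan_cong)
      fix x :: "nat \<Rightarrow> 'a"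
      show "mon m u x = mon m ?v x"
        using mon_nonreduced[of i j m u x] i M(1,2) ui unfolding q by simp
    qed
  next
    case 3
    then obtain \<nu> where \<nu>: "\<nu> \<in> S" "mono_dvd \<nu> u" by (auto simp: nabla_def)
    obtain g where g: "is_lead m d \<nu> g" "\<forall>x\<in>X. peval m d g x = 0" using S[OF \<nu>(1)] by blast
    have \<nu>m: "\<nu> \<in> monoms m d" and g\<nu>: "g \<nu> \<noteq> 0" using g(1) by (auto simp: is_lead_def)
    define s where "s = (\<lambda>i. u i - \<nu> i)"
    have us: "u = (\<lambda>i. s i + \<nu> i)" using \<nu>(2) by (auto simp: s_def mono_dvd_def)
    have sm: "s \<in> monoms m (e - d)"
    proof -
      have "(\<Sum>i\<le>m. u i) = (\<Sum>i\<le>m. s i) + (\<Sum>i\<le>m. \<nu> i)" by (simp add: us sum.distrib)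
      then show ?thesis using less.prems \<nu>m by (auto simp: monoms_def s_def)
    qed
    have de: "d \<le> e"
      using monoms_sum[OF less.prems] monoms_sum[OF \<nu>m] sum_mono[of "{..m}" \<nu> u] \<nu>(2)
      by (auto simp: mono_dvd_def)
    let ?h = "\<lambda>w x. (- (g w / g \<nu>)) * mon m (\<lambda>i. s i + w i) x"
    have "(\<lambda>x. \<Sum>w\<in>monoms m d - {\<nu>}. ?h w x) \<in> mspan m ?D X"
    proof (rule mspan_sum)
      fix w assume w: "w \<in> monoms m d - {\<nu>}"
      show "?h w \<in> mspan m ?D X"
      proof (cases "g w = 0")
        case True
        then show ?thesis using mspan_zero by simp
      next
        case False
        then have "lex_less w \<nu>" using g(1) w by (auto simp: is_lead_def)
        then have "lex_less (\<lambda>i. s i + w i) u" unfolding us lex_less_def by auto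
        moreover have "(\<lambda>i. s i + w i) \<in> monoms m e"
          using monoms_add[OF sm, of w d] w de by simp
        ultimately show ?thesis by (intro mspan_smult IH)
      qed
    qed (simp add: finite_monoms)
    then show ?thesis
    proof (rule mspan_cong)
      fix x assume "x \<in> X"
      then have "(\<Sum>w\<in>monoms m d. g w * mon m w x) = 0" using g(2) by (simp add: peval_def mon_def)
      then have "g \<nu> * mon m \<nu> x + (\<Sum>w\<in>monoms m d - {\<nu>}. g w * mon m w x) = 0"
        using sum.remove[OF finite_monoms \<nu>m, of "\<lambda>w. g w * mon m w x"] by simp
      then have "g \<nu> * mon m \<nu> x = - (\<Sum>w\<in>monoms m d - {\<nu>}. g w * mon m w x)"
        by (rule eq_neg_iff_add_eq_0[THEN iffD2])
      then have "mon m \<nu> x = (- (\<Sum>w\<in>monoms m d - {\<nu>}. g w * mon m w x)) / g \<nu>"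
        using g\<nu> by (metis nonzero_mult_div_cancel_left)
      also have "\<dots> = (\<Sum>w\<in>monoms m d - {\<nu>}. (- (g w / g \<nu>)) * mon m w x)"
        by (simp add: sum_negf sum_divide_distrib)
      finally have "mon m s x * mon m \<nu> x = mon m s x * (\<Sum>w\<in>monoms m d - {\<nu>}. (- (g w / g \<nu>)) * mon m w x)"
        by simp
      also have "\<dots> = (\<Sum>w\<in>monoms m d - {\<nu>}. ?h w x)"
        by (simp add: sum_distrib_left mon_add mult.left_commute)
      finally show "mon m u x = (\<Sum>w\<in>monoms m d - {\<nu>}. ?h w x)" by (simp add: us mon_add)
    qed
  qed
qed

lemma equiv_proj_rel: "equiv (vecs m - {\<lambda>_. 0}) (proj_rel m :: ((nat \<Rightarrow> 'a::field) \<times> _) set)"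
proof (rule equivI)
  show "refl_on (vecs m - {\<lambda>_. 0}) (proj_rel m :: ((nat \<Rightarrow> 'a) \<times> _) set)"
    by (auto simp: refl_on_def proj_rel_def intro: exI[of _ 1])
  show "sym (proj_rel m :: ((nat \<Rightarrow> 'a) \<times> _) set)"
  proof (rule symI)
    fix x y :: "nat \<Rightarrow> 'a" assume xy: "(x, y) \<in> proj_rel m"
    then obtain c where "c \<noteq> 0" "y = (\<lambda>i. c * x i)" by (auto simp: proj_rel_def)
    then have "inverse c \<noteq> 0 \<and> x = (\<lambda>i. inverse c * y i)" by (auto simp: field_simps)
    then have "\<exists>c. c \<noteq> 0 \<and> x = (\<lambda>i. c * y i)" by blast
    then show "(y, x) \<in> proj_rel m" using xy by (simp add: proj_rel_def)
  qed
  show "trans (proj_rel m :: ((nat \<Rightarrow> 'a) \<times> _) set)"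
  proof (rule transI)
    fix x y z :: "nat \<Rightarrow> 'a" assume xyz: "(x, y) \<in> proj_rel m" "(y, z) \<in> proj_rel m"
    then obtain c c' where "c \<noteq> 0" "y = (\<lambda>i. c * x i)" "c' \<noteq> 0" "z = (\<lambda>i. c' * y i)"
      by (auto simp: proj_rel_def)
    then have "c' * c \<noteq> 0 \<and> z = (\<lambda>i. (c' * c) * x i)" by (auto simp: mult.assoc)
    then have "\<exists>c. c \<noteq> 0 \<and> z = (\<lambda>i. c * x i)" by blast
    then show "(x, z) \<in> proj_rel m" using xyz by (simp add: proj_rel_def)
  qed
qed (auto simp: proj_rel_def)

lemma forms_subset_mspan:
  assumes "f \<in> forms m e" "\<And>u. u \<in> monoms m e \<Longrightarrow> mon m u \<in> mspan m D X"
  shows "f \<in> mspan m D X"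
  using assms(1) by induction (auto intro: assms(2) mspan_zero mspan_add mspan_smult)

text \<open>By the separating forms, every function on the zero set is given by a form of degree e,
  hence by coefficients on \<open>Delta\<close>. Comparing the q^|V| functions with the q^|D|
  coefficient vectors takes the place of a dimension argument.\<close>

lemma card_zero_set_le_Delta:
  fixes F :: "nat \<Rightarrow> (nat \<Rightarrow> nat) \<Rightarrow> 'a::{field,finite}"
  assumes q: "q = card (UNIV :: 'a set)"
    and S: "\<And>\<nu>. \<nu> \<in> S \<Longrightarrow> \<exists>g. is_lead m d \<nu> g \<and> (\<forall>P\<in>zero_set m d r F. \<forall>x\<in>P. peval m d g x = 0)"
    and e: "m * (q - 1) < e"
  shows "card (zero_set m d r F) \<le> card (Delta q m e S)"
\<comment> \<open>An infinite set would have \<open>card\<close> 0 and satisfy the bound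
  trivially.\<close>
proof (cases "finite (zero_set m d r F)")
  case True
  define V where "V = zero_set m d r F"
  define D where "D = Delta q m e S"
  \<comment> \<open>Forms have no value at a projective point, so one representative is fixed in
    each class.\<close>
  define \<rho> where "\<rho> = (\<lambda>P :: (nat \<Rightarrow> 'a) set. SOME x. x \<in> P)"
  have q1: "1 < q"
  proof -
    have "card {0, 1 :: 'a} \<le> q" unfolding q by (rule card_mono) auto
    then show ?thesis by simp
  qed
  have finD: "finite D" unfolding D_def
    by (rule finite_subset[OF _ finite_monoms[of m e]]) (auto simp: Delta_def red_monos_def)
  have VP: "P \<in> (vecs m - {\<lambda>_. 0}) // proj_rel m" if "P \<in> V" for P
    using that by (simp add: V_def zero_set_def proj_points_def)
  have \<rho>: "\<rho> P \<in> P" "\<rho> P \<in> vecs m - {\<lambda>_. 0}" if "P \<in> V" for P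
  proof -
    have "P \<noteq> {}" using in_quotient_imp_non_empty[OF equiv_proj_rel VP[OF that]] .
    then show "\<rho> P \<in> P" by (simp add: \<rho>_def some_in_eq)
    then show "\<rho> P \<in> vecs m - {\<lambda>_. 0}"
      using in_quotient_imp_subset[OF equiv_proj_rel VP[OF that]] by blast
  qed
  have sep: "P = P'" if "P \<in> V" "P' \<in> V" "c \<noteq> 0" "\<rho> P' = (\<lambda>i. c * \<rho> P i)" for P P' c
  proof -
    have "\<exists>c. c \<noteq> 0 \<and> \<rho> P' = (\<lambda>i. c * \<rho> P i)" using that by blast
    then have "(\<rho> P, \<rho> P') \<in> proj_rel m" using \<rho>[OF that(1)] \<rho>[OF that(2)] by (simp add: proj_rel_def)
    then show ?thesis
      using quotient_eq_iff[OF equiv_proj_rel VP[OF that(1)] VP[OF that(2)] \<rho>(1)[OF that(1)] \<rho>(1)[OF that(2)]]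
      by simp
  qed
  have "\<exists>f \<in> forms m e. f (\<rho> P) \<noteq> 0 \<and> (\<forall>P'\<in>V. P' \<noteq> P \<longrightarrow> f (\<rho> P') = 0)" if P: "P \<in> V" for P
  proof -
    obtain f where f: "f \<in> forms m e" "f (\<rho> P) \<noteq> 0"
        "\<forall>y \<in> vecs m. f y \<noteq> 0 \<longrightarrow> (\<exists>c. c \<noteq> 0 \<and> y = (\<lambda>i. c * \<rho> P i))"
      using exists_separating_form[OF \<rho>(2)[OF P], of e] e q1 unfolding q by blast
    have "f (\<rho> P') = 0" if P': "P' \<in> V" "P' \<noteq> P" for P'
    proof (rule ccontr)
      assume "f (\<rho> P') \<noteq> 0"
      then obtain c where "c \<noteq> 0" "\<rho> P' = (\<lambda>i. c * \<rho> P i)" using f(3) \<rho>(2)[OF P'(1)] by blast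
      then show False using sep[OF P P'(1)] P'(2) by blast
    qed
    then show ?thesis using f by blast
  qed
  then obtain G where G: "\<And>P. P \<in> V \<Longrightarrow> G P \<in> forms m e" "\<And>P. P \<in> V \<Longrightarrow> G P (\<rho> P) \<noteq> 0"
      "\<And>P P'. P \<in> V \<Longrightarrow> P' \<in> V \<Longrightarrow> P' \<noteq> P \<Longrightarrow> G P (\<rho> P') = 0"
    by metis
  have mons: "mon m u \<in> mspan m D (\<Union>V)" if "u \<in> monoms m e" for u
    unfolding D_def
  proof (rule mon_in_mspan_Delta[OF q _ _ that])
    show "0 < e" using e by simp
    fix \<nu> assume "\<nu> \<in> S"
    then show "\<exists>g. is_lead m d \<nu> g \<and> (\<forall>x\<in>\<Union>V. peval m d g x = 0)"
      using S[of \<nu>] unfolding V_def by blast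
  qed
  let ?ev = "\<lambda>c. \<lambda>P\<in>V. \<Sum>u\<in>D. c u * mon m u (\<rho> P)"
  have "(V \<rightarrow>\<^sub>E (UNIV :: 'a set)) \<subseteq> ?ev ` (D \<rightarrow>\<^sub>E UNIV)"
  proof
    fix \<phi> :: "(nat \<Rightarrow> 'a) set \<Rightarrow> 'a" assume \<phi>: "\<phi> \<in> V \<rightarrow>\<^sub>E UNIV"
    define f where "f = (\<lambda>x. \<Sum>P\<in>V. (\<phi> P / G P (\<rho> P)) * G P x)"
    have fV: "f (\<rho> P) = \<phi> P" if "P \<in> V" for P
    proof -
      have "f (\<rho> P) = (\<phi> P / G P (\<rho> P)) * G P (\<rho> P) + (\<Sum>P'\<in>V - {P}. (\<phi> P' / G P' (\<rho> P')) * G P' (\<rho> P))"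
        unfolding f_def using True that by (subst sum.remove[of _ P]) (auto simp: V_def)
      also have "(\<Sum>P'\<in>V - {P}. (\<phi> P' / G P' (\<rho> P')) * G P' (\<rho> P)) = 0"
        using G(3)[OF _ that] by (intro sum.neutral) auto
      finally show ?thesis using G(2)[OF that] by simp
    qed
    have "f \<in> forms m e" unfolding f_def
      using True G(1) by (intro forms_sum forms.smult) (auto simp: V_def)
    then have "f \<in> mspan m D (\<Union>V)" using mons by (rule forms_subset_mspan)
    then obtain c where c: "\<forall>x\<in>\<Union>V. f x = (\<Sum>u\<in>D. c u * mon m u x)" by (auto simp: mspan_def)
    have "\<phi> = ?ev (restrict c D)"
    proof
      fix P
      show "\<phi> P = ?ev (restrict c D) P"
      proof (cases "P \<in> V")
        case P: True
        then have "\<phi> P = (\<Sum>u\<in>D. c u * mon m u (\<rho> P))" using c fV[OF P] \<rho>(1)[OF P] by (metis UnionI)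
        then show ?thesis using P by simp
      next
        case False
        then show ?thesis using PiE_arb[OF \<phi>] by simp
      qed
    qed
    moreover have "restrict c D \<in> D \<rightarrow>\<^sub>E UNIV" by simp
    ultimately show "\<phi> \<in> ?ev ` (D \<rightarrow>\<^sub>E UNIV)" by blast
  qed
  moreover have "finite (D \<rightarrow>\<^sub>E (UNIV :: 'a set))" using finD by (intro finite_PiE) auto
  ultimately have "card (V \<rightarrow>\<^sub>E (UNIV :: 'a set)) \<le> card (D \<rightarrow>\<^sub>E (UNIV :: 'a set))"
    by (rule surj_card_le[rotated])
  then have "q ^ card V \<le> q ^ card D"
    using True finD by (simp add: card_PiE q V_def)
  then show ?thesis using q1 by (simp add: V_def D_def)
qed simp

section \<open>Leading monomials of linearly independent forms\<close>

lemma exists_is_lead: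
  assumes "homog m d g" "g \<noteq> (\<lambda>_. 0)"
  shows "\<exists>\<nu>. is_lead m d \<nu> g"
proof -
  let ?A = "{w \<in> monoms m d. g w \<noteq> 0}"
  have "?A \<noteq> {}" using assms by (auto simp: homog_def fun_eq_iff)
  moreover have "finite ?A" using finite_monoms by simp
  ultimately obtain \<nu> where "\<nu> \<in> ?A" "\<forall>w\<in>?A. \<not> lex_less \<nu> w" using finite_lex_max by blast
  then show ?thesis using lex_less_total unfolding is_lead_def by blast
qed

lemma peval_lincomb:
  "peval m d (\<lambda>\<mu>. \<Sum>i<r. c i * F i \<mu>) x = (\<Sum>i<r. c i * peval m d (F i) x)"
proof -
  have "peval m d (\<lambda>\<mu>. \<Sum>i<r. c i * F i \<mu>) x
      = (\<Sum>\<mu>\<in>monoms m d. \<Sum>i<r. c i * (F i \<mu> * (\<Prod>i\<le>m. x i ^ \<mu> i)))"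
    unfolding peval_def by (simp add: sum_distrib_right mult.assoc)
  also have "\<dots> = (\<Sum>i<r. \<Sum>\<mu>\<in>monoms m d. c i * (F i \<mu> * (\<Prod>i\<le>m. x i ^ \<mu> i)))"
    by (rule sum.swap)
  finally show ?thesis unfolding peval_def by (simp add: sum_distrib_left)
qed

text \<open>A combination is determined by its coefficients on the set \<open>LM\<close> of all
  leading monomials: by independence the difference of two distinct ones is a nonzero form, and its
  leading coefficient sits in \<open>LM\<close>. Counting gives q^r \<le> q^|LM|, in place of an
  elimination.\<close>

lemma exists_leading_monomials:
  fixes F :: "nat \<Rightarrow> (nat \<Rightarrow> nat) \<Rightarrow> 'a::{field,finite}"
  assumes hom: "\<forall>i<r. homog m d (F i)" and li: "lin_indep r F"
  shows "\<exists>S \<subseteq> monoms m d. card S = r \<and> (\<forall>\<nu>\<in>S. \<exists>c. is_lead m d \<nu> (\<lambda>\<mu>. \<Sum>i<r. c i * F i \<mu>))"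
proof -
  let ?comb = "\<lambda>c \<mu>. \<Sum>i<r. c i * F i \<mu>"
  define LM where "LM = {\<nu> \<in> monoms m d. \<exists>c. is_lead m d \<nu> (?comb c)}"
  have fin: "finite LM" using finite_monoms by (simp add: LM_def)
  have inj: "inj_on (\<lambda>c. restrict (?comb c) LM) ({..<r} \<rightarrow>\<^sub>E (UNIV :: 'a set))"
  proof (rule inj_onI, rule ccontr)
    fix c c' assume c: "c \<in> {..<r} \<rightarrow>\<^sub>E (UNIV :: 'a set)" "c' \<in> {..<r} \<rightarrow>\<^sub>E (UNIV :: 'a set)"
      and eq: "restrict (?comb c) LM = restrict (?comb c') LM" and ne: "c \<noteq> c'"
    let ?b = "\<lambda>i. c i - c' i"
    have diff: "?comb ?b \<mu> = ?comb c \<mu> - ?comb c' \<mu>" for \<mu>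
      by (simp add: left_diff_distrib sum_subtractf)
    have "?comb ?b \<noteq> (\<lambda>_. 0)"
    proof
      assume "?comb ?b = (\<lambda>_. 0)"
      then have "\<forall>\<mu>. ?comb ?b \<mu> = 0" by meson
      then have "\<forall>i<r. ?b i = 0" using li[unfolded lin_indep_def, THEN spec, of ?b] by simp
      then have "c i = c' i" for i
        using PiE_arb[OF c(1), of i] PiE_arb[OF c(2), of i] by (cases "i < r") auto
      then show False using ne by auto
    qed
    moreover have "homog m d (?comb ?b)"
      unfolding homog_def
    proof (intro allI impI)
      fix \<mu> assume "?comb ?b \<mu> \<noteq> 0"
      then obtain i where "i < r" "?b i * F i \<mu> \<noteq> 0" by (meson lessThan_iff sum.neutral)
      then show "\<mu> \<in> monoms m d" using hom by (auto simp: homog_def)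
    qed
    ultimately obtain \<nu> where \<nu>: "is_lead m d \<nu> (?comb ?b)" using exists_is_lead by blast
    then have "\<nu> \<in> monoms m d" by (simp add: is_lead_def)
    with \<nu> have "\<nu> \<in> LM" unfolding LM_def by (intro CollectI conjI exI[of _ ?b])
    then have "?comb c \<nu> = ?comb c' \<nu>" using fun_cong[OF eq, of \<nu>] by simp
    then have "?comb ?b \<nu> = 0" using diff by simp
    then show False using \<nu> by (simp add: is_lead_def)
  qed
  have img: "(\<lambda>c. restrict (?comb c) LM) ` ({..<r} \<rightarrow>\<^sub>E (UNIV :: 'a set)) \<subseteq> LM \<rightarrow>\<^sub>E UNIV"
    by (rule image_subsetI) simp
  have "finite (LM \<rightarrow>\<^sub>E (UNIV :: 'a set))" using fin by (intro finite_PiE) auto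
  from card_inj_on_le[OF inj img this]
  have "card ({..<r} \<rightarrow>\<^sub>E (UNIV :: 'a set)) \<le> card (LM \<rightarrow>\<^sub>E (UNIV :: 'a set))" .
  then have "card (UNIV :: 'a set) ^ r \<le> card (UNIV :: 'a set) ^ card LM"
    using fin by (simp add: card_PiE)
  moreover have "1 < card (UNIV :: 'a set)"
  proof -
    have "card {0, 1 :: 'a} \<le> card (UNIV :: 'a set)" by (rule card_mono) auto
    then show ?thesis by simp
  qed
  ultimately have "r \<le> card LM" by simp
  then obtain S where "S \<subseteq> LM" "card S = r" using obtain_subset_with_card_n by blast
  then show ?thesis unfolding LM_def by blast
qed

lemma card_zero_set_le_K:
  fixes F :: "nat \<Rightarrow> (nat \<Rightarrow> nat) \<Rightarrow> 'a::{field,finite}"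
  assumes q: "card (UNIV :: 'a set) = q" and d: "1 \<le> d" "d < q"
    and r: "1 \<le> r" "r \<le> (m + d) choose m"
    and F: "\<forall>i<r. homog m d (F i)" "lin_indep r F"
  shows "card (zero_set m d r F) \<le> K_fun q r d m"
proof -
  obtain S where S: "S \<subseteq> monoms m d" "card S = r"
      "\<And>\<nu>. \<nu> \<in> S \<Longrightarrow> \<exists>c. is_lead m d \<nu> (\<lambda>\<mu>. \<Sum>i<r. c i * F i \<mu>)"
    using exists_leading_monomials[OF F] by blast
  \<comment> \<open>Large enough for both uses: it meets the threshold of the combinatorial bound
    and, as d \<ge> 1, exceeds the m (q - 1) required by the separating forms.\<close>
  let ?e = "m * (q - 1) + d"
  have "card (zero_set m d r F) \<le> card (Delta q m ?e S)"
  proof (rule card_zero_set_le_Delta)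
    fix \<nu> assume "\<nu> \<in> S"
    then obtain c where c: "is_lead m d \<nu> (\<lambda>\<mu>. \<Sum>i<r. c i * F i \<mu>)" using S(3) by blast
    have "peval m d (\<lambda>\<mu>. \<Sum>i<r. c i * F i \<mu>) x = 0" if "P \<in> zero_set m d r F" "x \<in> P" for P x
      unfolding peval_lincomb using that by (intro sum.neutral) (auto simp: zero_set_def)
    then show "\<exists>g. is_lead m d \<nu> g \<and> (\<forall>P\<in>zero_set m d r F. \<forall>x\<in>P. peval m d g x = 0)"
      using c by blast
  qed (use q d in auto)
  also have "\<dots> \<le> K_fun q r d m"
    by (rule card_Delta_le_K[OF _ _ _ S(1,2) r]) (use d in auto)
  finally show ?thesis .
qed

text \<open>Distinct monomials are independent. This keeps the set whose maximum defines
  \<open>e_fun\<close> nonempty.\<close>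

lemma exists_lin_indep:
  assumes "r \<le> (m + d) choose m"
  shows "\<exists>F :: nat \<Rightarrow> (nat \<Rightarrow> nat) \<Rightarrow> 'a::field. (\<forall>i<r. homog m d (F i)) \<and> lin_indep r F"
proof -
  obtain h where h: "h ` {..<r} \<subseteq> monoms m d" "inj_on h {..<r}"
    using card_le_inj[of "{..<r}" "monoms m d"] assms finite_monoms by (auto simp: card_monoms)
  define F :: "nat \<Rightarrow> (nat \<Rightarrow> nat) \<Rightarrow> 'a" where "F = (\<lambda>i \<mu>. if \<mu> = h i then 1 else 0)"
  have "homog m d (F i)" if "i < r" for i using h(1) that by (auto simp: homog_def F_def)
  moreover have "lin_indep r F" unfolding lin_indep_def
  proof (intro allI impI)
    fix c :: "nat \<Rightarrow> 'a" and j assume 0: "\<forall>\<mu>. (\<Sum>i<r. c i * F i \<mu>) = 0" and j: "j < r"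
    have "(\<Sum>i<r. c i * F i (h j)) = (\<Sum>i<r. if i = j then c j else 0)"
      using h(2) j by (intro sum.cong) (auto simp: F_def inj_on_def)
    then show "c j = 0" using 0 j by simp
  qed
  ultimately show ?thesis by blast
qed

theorem theorem5p8:
  fixes q d m r :: nat
  assumes "card (UNIV :: 'a::{field,finite} set) = q"
    and "1 \<le> m"
    and "1 \<le> d" and "d < q"
    and "1 \<le> r" and "r \<le> (m + d) choose m"
  shows "(\<exists>e0. \<forall>e\<ge>e0. A_fun q r d m e = K_fun q r d m)
         \<and> e_fun TYPE('a) r d m \<le> K_fun q r d m"
proof
  show "\<exists>e0. \<forall>e\<ge>e0. A_fun q r d m e = K_fun q r d m"
    using A_fun_eq_K[of d q m _ r] assms by (intro exI[of _ "m * (q - 1) + d"]) auto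
  let ?V = "{card (zero_set m d r (F :: nat \<Rightarrow> (nat \<Rightarrow> nat) \<Rightarrow> 'a)) | F.
       (\<forall>i<r. homog m d (F i)) \<and> lin_indep r F}"
  have le: "y \<le> K_fun q r d m" if "y \<in> ?V" for y
    using that card_zero_set_le_K[OF assms(1,3-6)] by blast
  \<comment> \<open>The bound itself makes the set of point counts finite, so that its
    \<open>Max\<close> is meaningful.\<close>
  then have "finite ?V" by (meson finite_nat_set_iff_bounded_le)
  moreover have "?V \<noteq> {}" using exists_lin_indep[OF assms(6), where ?'a = 'a] by blast
  ultimately show "e_fun TYPE('a) r d m \<le> K_fun q r d m"
    unfolding e_fun_def using le by (intro Max.boundedI) auto
qed

end
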